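(* Let $K$ be a perfect field, $V$ a finite-dimensional $K$-vector space, $d\ge 1$ an integer, and $D^dV\subseteq V^{\otimes d}$ the space of symmetric tensors. For every symmetric tensor $v\in D^dV$, the symmetric $G$-stable rank and the $G$-stable rank of $v$ coincide: $$\operatorname{symmrk}^G(v)=\operatorname{rk}^G(v).$$
   Context: $D^dV\subseteq V^{\otimes d}$ is the subspace of tensors invariant under the symmetric group $S_d$ permuting the tensor factors. A 1-parameter subgroup of an algebraic group $H$ over $K$ is a homomorphism of algebraic groups $\lambda:\mathbb G_m\to H$ over $K$. The group $\mathrm{GL}(V)^d$ acts on $V^{\otimes d}$ factorwise, and $\mathrm{GL}(V)$ acts on $V^{\otimes d}$ and $D^dV$ through the diagonal embedding $\mathrm{GL}(V)\hookrightarrow \mathrm{GL}(V)^d$. A 1-parameter subgroup $\lambda(t)$ of $\mathrm{GL}(V)$, viewed as an invertible matrix with entries in $K[t,t^{-1}]$, is polynomial if all its entries lie in $K[t]$; a 1-parameter subgroup $\lambda(t)=(\lambda_1(t),\dots,\lambda_d(t))$ of $\mathrm{GL}(V)^d$ is polynomial if every $\lambda_i(t)$ is. For $a\in K(t)$, $\operatorname{val}(a)$ is its $t$-adic valuation (order at $t=0$, with $\operatorname{val}(0)=+\infty$). For a vector $u(t)\in K(t)\otimes_K V^{\otimes d}$, $\operatorname{val}(u(t))$ is the minimum of the valuations of its coordinates with respect to a $K$-basis of $V^{\otimes d}$. The $G$-stable rank of $v\in V^{\otimes d}$ is $$\operatorname{rk}^G(v)=\inf_{\lambda}\frac{\sum_{i=1}^d\operatorname{val}(\det\lambda_i(t))}{\operatorname{val}(\lambda(t)\cdot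 v)},$$ the infimum over all polynomial 1-parameter subgroups $\lambda=(\lambda_1,\dots,\lambda_d)$ of $\mathrm{GL}(V)^d$ with $\operatorname{val}(\lambda(t)\cdot v)>0$. The symmetric $G$-stable rank of $v\in D^dV$ is $$\operatorname{symmrk}^G(v)=\inf_{\lambda}\; d\,\frac{\operatorname{val}(\det\lambda(t))}{\operatorname{val}(\lambda(t)\cdot v)},$$ the infimum over all polynomial 1-parameter subgroups $\lambda$ of $\mathrm{GL}(V)$ with $\operatorname{val}(\lambda(t)\cdot v)>0$. A quotient with denominator $+\infty$ (which occurs only for $v=0$) is read as $0$. *)

theory Defs
  imports
    Jordan_Normal_Form.Determinant
    "HOL-Computational_Algebra.Formal_Laurent_Series"
    "HOL-Library.Extended_Real"
    "HOL-Library.FuncSet"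
    "HOL-Combinatorics.Permutations"
begin

definition perfect_field :: "'k::field itself \<Rightarrow> bool" where
  "perfect_field _ \<longleftrightarrow> CHAR('k) = 0 \<or> surj (\<lambda>x::'k. x ^ CHAR('k))"

text \<open>The space \<open>V\<close> is \<open>K\<^sup>n\<close>, where \<open>n = 0\<close> is allowed. The standard basis of the \<open>d\<close>-th
  tensor power is indexed by the maps \<open>{..<d} \<rightarrow> {..<n}\<close>, and a tensor is its family of coordinates.\<close>

definition multi_indices :: "nat \<Rightarrow> nat \<Rightarrow> (nat \<Rightarrow> nat) set" where
  "multi_indices n d = ({..<d} \<rightarrow>\<^sub>E {..<n})"

definition tensors :: "nat \<Rightarrow> nat \<Rightarrow> ((nat \<Rightarrow> nat) \<Rightarrow> 'k::field) set" where
  "tensors n d = {v. \<forall>I. I \<notin> multi_indices n d \<longrightarrow> v I = 0}"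

text \<open>Precomposition with \<open>\<pi>\<close> maps \<open>multi_indices n d\<close> to itself, since \<open>\<pi>\<close> fixes every \<open>i \<ge> d\<close>.\<close>

definition symmetric_tensors :: "nat \<Rightarrow> nat \<Rightarrow> ((nat \<Rightarrow> nat) \<Rightarrow> 'k::field) set" where
  "symmetric_tensors n d =
     {v \<in> tensors n d. \<forall>\<pi>. \<pi> permutes {..<d} \<longrightarrow> (\<forall>I\<in>multi_indices n d. v (I \<circ> \<pi>) = v I)}"

text \<open>\<open>K[t, t\<^sup>-\<^sup>1]\<close> and \<open>K[t]\<close> as subrings of the field of formal Laurent series. All vectors
  \<open>u(t)\<close> considered below have coordinates in \<open>K[t, t\<^sup>-\<^sup>1]\<close>, and the valuation of \<open>K(t)\<close> is the
  restriction of the one of \<open>K((t))\<close>.\<close>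

definition laurent_polys :: "'k::field fls set" where
  "laurent_polys = {f. finite {m. fls_nth f m \<noteq> 0}}"

definition ordinary_polys :: "'k::field fls set" where
  "ordinary_polys = {f \<in> laurent_polys. \<forall>m<0. fls_nth f m = 0}"

definition val :: "'k::field fls \<Rightarrow> ereal" where
  "val f = (if f = 0 then \<infinity> else ereal (of_int (fls_subdegree f)))"

text \<open>The group law of \<open>\<G>\<^sub>m\<close> is tested on the universal point \<open>(s, t)\<close>, that is, in
  \<open>K[s, s\<^sup>-\<^sup>1, t, t\<^sup>-\<^sup>1]\<close>, realised inside the field \<open>K((t))((s))\<close>. Testing it on the points of
  \<open>K\<close> would be too weak for finite \<open>K\<close>.\<close>

definition laurent_subst :: "'k::field fls \<Rightarrow> 'k fls fls \<Rightarrow> 'k fls fls" where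
  "laurent_subst f x =
     (\<Sum>m | fls_nth f m \<noteq> 0. fls_const (fls_const (fls_nth f m)) * x powi m)"

definition var_s :: "'k::field fls fls" where "var_s = fls_X"

definition var_t :: "'k::field fls fls" where "var_t = fls_const fls_X"

text \<open>A morphism from \<open>\<G>\<^sub>m\<close> to \<open>GL\<^sub>n\<close> over \<open>K\<close> is an element of \<open>GL\<^sub>n(K[t, t\<^sup>-\<^sup>1])\<close>.\<close>

definition one_param_subgroup :: "nat \<Rightarrow> 'k::field fls mat \<Rightarrow> bool" where
  "one_param_subgroup n A \<longleftrightarrow>
     A \<in> carrier_mat n n \<and> elements_mat A \<subseteq> laurent_polys \<and>
     (\<exists>B \<in> carrier_mat n n. elements_mat B \<subseteq> laurent_polys \<and> A * B = 1\<^sub>m n \<and> B * A = 1\<^sub>m n) \<and>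
     map_mat (\<lambda>f. laurent_subst f (var_s * var_t)) A =
       map_mat (\<lambda>f. laurent_subst f var_s) A * map_mat (\<lambda>f. laurent_subst f var_t) A"

definition polynomial_1ps :: "nat \<Rightarrow> 'k::field fls mat \<Rightarrow> bool" where
  "polynomial_1ps n A \<longleftrightarrow> one_param_subgroup n A \<and> elements_mat A \<subseteq> ordinary_polys"

text \<open>A 1-parameter subgroup of \<open>GL(V)\<^sup>d\<close> is given by its \<open>d\<close> components; only the values
  \<open>lam i\<close> with \<open>i < d\<close> matter.\<close>

definition polynomial_1ps_prod :: "nat \<Rightarrow> nat \<Rightarrow> (nat \<Rightarrow> 'k::field fls mat) \<Rightarrow> bool" where
  "polynomial_1ps_prod n d lam \<longleftrightarrow> (\<forall>i<d. polynomial_1ps n (lam i))"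

definition act ::
    "nat \<Rightarrow> nat \<Rightarrow> (nat \<Rightarrow> 'k::field fls mat) \<Rightarrow> ((nat \<Rightarrow> nat) \<Rightarrow> 'k) \<Rightarrow> (nat \<Rightarrow> nat) \<Rightarrow> 'k fls" where
  "act n d lam v I =
     (\<Sum>J\<in>multi_indices n d. (\<Prod>i<d. lam i $$ (I i, J i)) * fls_const (v J))"

definition tensor_val :: "nat \<Rightarrow> nat \<Rightarrow> ((nat \<Rightarrow> nat) \<Rightarrow> 'k::field fls) \<Rightarrow> ereal" where
  "tensor_val n d u = (INF I\<in>multi_indices n d. val (u I))"

text \<open>In \<open>ereal\<close> a quotient by \<open>\<infinity>\<close> is \<open>0\<close>.\<close>

definition stable_rank :: "nat \<Rightarrow> nat \<Rightarrow> ((nat \<Rightarrow> nat) \<Rightarrow> 'k::field) \<Rightarrow> ereal" where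
  "stable_rank n d v =
     (INF lam \<in> {lam. polynomial_1ps_prod n d lam \<and> tensor_val n d (act n d lam v) > 0}.
        (\<Sum>i<d. val (det (lam i))) / tensor_val n d (act n d lam v))"

definition symm_stable_rank :: "nat \<Rightarrow> nat \<Rightarrow> ((nat \<Rightarrow> nat) \<Rightarrow> 'k::field) \<Rightarrow> ereal" where
  "symm_stable_rank n d v =
     (INF A \<in> {A. polynomial_1ps n A \<and> tensor_val n d (act n d (\<lambda>_. A) v) > 0}.
        ereal (real d) * (val (det A) / tensor_val n d (act n d (\<lambda>_. A) v)))"

end

theory Submission
  imports Defs
begin

text \<open>Every 1-parameter subgroup of \<open>GL\<^sub>n\<close> over \<open>K\<close> is conjugate over \<open>K\<close> to a diagonal one, so a tuple
  \<open>\<lambda>\<close> amounts to \<open>d\<close> weighted bases, and \<open>val (\<lambda>(t) \<cdot> v) \<ge> m\<close> says that only basis tensors of weight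
  at least \<open>m\<close> occur in \<open>v\<close>. This depends only on the \<open>d\<close> weighted flags. For symmetric \<open>v\<close> the flags may
  be permuted, and two flags have a common adapted basis (Bruhat decomposition), in which weights
  can be added. If the first \<open>k\<close> flags agree, adding up the \<open>k + 1\<close> tuples in which the next flag
  is moved to each of the first \<open>k + 1\<close> positions makes the first \<open>k + 1\<close> flags agree and multiplies
  both \<open>m\<close> and the total weight by \<open>k + 1\<close>. After \<open>d - 1\<close> steps all flags are equal and the
  quotient is unchanged.\<close>

unbundle no Formal_Power_Series.fps_syntax

section \<open>Base change and permutation of tensors\<close>

text \<open>The formula of \<open>act\<close>, with the tensor over the same ring as the matrices.
  In this form the operation can be iterated and used over \<open>K\<close> as well as over
  \<open>K((t))\<close>.\<close>

definition tensor_act ::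
    "nat \<Rightarrow> nat \<Rightarrow> (nat \<Rightarrow> 'a::comm_ring_1 mat) \<Rightarrow> ((nat \<Rightarrow> nat) \<Rightarrow> 'a) \<Rightarrow> (nat \<Rightarrow> nat) \<Rightarrow> 'a" where
  "tensor_act n d h u I = (\<Sum>J\<in>multi_indices n d. (\<Prod>i<d. h i $$ (I i, J i)) * u J)"

lemma finite_multi_indices [simp]: "finite (multi_indices n d)"
  by (simp add: multi_indices_def finite_PiE)

lemma multi_indicesD: "I \<in> multi_indices n d \<Longrightarrow> i < d \<Longrightarrow> I i < n"
  by (auto simp: multi_indices_def PiE_iff)

lemma multi_indices_comp_permutes:
  assumes "\<pi> permutes {..<d}" "I \<in> multi_indices n d"
  shows "I \<circ> \<pi> \<in> multi_indices n d"
proof -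
  have "(I \<circ> \<pi>) i < n" if "i < d" for i
    using multi_indicesD[OF assms(2)] permutes_in_image[OF assms(1), of i] that by auto
  moreover have "(I \<circ> \<pi>) i = undefined" if "\<not> i < d" for i
    using assms that permutes_not_in[OF assms(1), of i]
    by (auto simp: multi_indices_def PiE_iff extensional_def)
  ultimately show ?thesis by (auto simp: multi_indices_def PiE_iff extensional_def)
qed

lemma mult_mat_entry:
  assumes "A \<in> carrier_mat n n" "B \<in> carrier_mat n n" "i < n" "j < n"
  shows "(A * B) $$ (i, j) = (\<Sum>k<n. A $$ (i, k) * B $$ (k, j))"
  using assms by (auto simp: scalar_prod_def atLeast0LessThan intro!: sum.cong)

lemma tensor_act_cong:
  assumes "\<And>i. i < d \<Longrightarrow> A i = B i" "\<And>J. J \<in> multi_indices n d \<Longrightarrow> u J = w J"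
  shows "tensor_act n d A u I = tensor_act n d B w I"
  using assms by (auto simp: tensor_act_def intro!: sum.cong arg_cong2[where f = "(*)"] prod.cong)

lemma tensor_act_mult:
  assumes A: "\<And>i. i < d \<Longrightarrow> A i \<in> carrier_mat n n"
    and B: "\<And>i. i < d \<Longrightarrow> B i \<in> carrier_mat n n"
    and I: "I \<in> multi_indices n d"
  shows "tensor_act n d (\<lambda>i. A i * B i) u I = tensor_act n d A (tensor_act n d B u) I"
proof -
  have "(\<Prod>i<d. (A i * B i) $$ (I i, J i)) =
      (\<Sum>L\<in>multi_indices n d. (\<Prod>i<d. A i $$ (I i, L i)) * (\<Prod>i<d. B i $$ (L i, J i)))"
    if J: "J \<in> multi_indices n d" for J
  proof -
    have "(\<Prod>i<d. (A i * B i) $$ (I i, J i)) = (\<Prod>i<d. \<Sum>k<n. A i $$ (I i, k) * B i $$ (k, J i))"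
    proof (rule prod.cong[OF refl])
      fix i assume "i \<in> {..<d}"
      then have i: "i < d" by simp
      show "(A i * B i) $$ (I i, J i) = (\<Sum>k<n. A i $$ (I i, k) * B i $$ (k, J i))"
        by (rule mult_mat_entry[OF A[OF i] B[OF i] multi_indicesD[OF I i] multi_indicesD[OF J i]])
    qed
    \<comment> \<open>Expanding the product of sums chooses one summation index per tensor position,
      and these choices form the multi-index \<open>L\<close>.\<close>
    also have "\<dots> = (\<Sum>L\<in>{..<d} \<rightarrow>\<^sub>E {..<n}. \<Prod>i<d. A i $$ (I i, L i) * B i $$ (L i, J i))"
      by (rule prod_sum_PiE) auto
    finally show ?thesis by (simp add: multi_indices_def prod.distrib)
  qed
  then have "tensor_act n d (\<lambda>i. A i * B i) u I = (\<Sum>J\<in>multi_indices n d. \<Sum>L\<in>multi_indices n d.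
      (\<Prod>i<d. A i $$ (I i, L i)) * (\<Prod>i<d. B i $$ (L i, J i)) * u J)"
    by (simp add: tensor_act_def sum_distrib_right)
  also have "\<dots> = (\<Sum>L\<in>multi_indices n d. \<Sum>J\<in>multi_indices n d.
      (\<Prod>i<d. A i $$ (I i, L i)) * (\<Prod>i<d. B i $$ (L i, J i)) * u J)"
    by (rule sum.swap)
  also have "\<dots> = tensor_act n d A (tensor_act n d B u) I"
    by (simp add: tensor_act_def sum_distrib_left mult.assoc)
  finally show ?thesis .
qed

lemma tensor_act_mat_diag:
  assumes I: "I \<in> multi_indices n d"
  shows "tensor_act n d (\<lambda>i. mat_diag n (D i)) u I = (\<Prod>i<d. D i (I i)) * u I"
proof -
  have "(\<Prod>i<d. mat_diag n (D i) $$ (I i, J i)) = (if J = I then (\<Prod>i<d. D i (I i)) else 0)"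
    if J: "J \<in> multi_indices n d" for J
  proof (cases "J = I")
    case True
    then show ?thesis using multi_indicesD[OF I] by (auto simp: mat_diag_def intro!: prod.cong)
  next
    case False
    have "\<exists>i<d. I i \<noteq> J i"
      using PiE_ext[of J "{..<d}" "\<lambda>_. {..<n}" I] I J False by (auto simp: multi_indices_def)
    then obtain i where i: "i < d" "I i \<noteq> J i" by auto
    then have "mat_diag n (D i) $$ (I i, J i) = 0"
      using multi_indicesD[OF I i(1)] multi_indicesD[OF J i(1)] by (simp add: mat_diag_def)
    then show ?thesis using False i by (auto intro!: prod_zero)
  qed
  then have "tensor_act n d (\<lambda>i. mat_diag n (D i)) u I =
      (\<Sum>J\<in>multi_indices n d. if J = I then (\<Prod>i<d. D i (I i)) * u J else 0)"
    unfolding tensor_act_def by (intro sum.cong refl) auto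
  also have "\<dots> = (\<Prod>i<d. D i (I i)) * u I"
    using I by (subst sum.delta) auto
  finally show ?thesis .
qed

lemma tensor_act_one:
  assumes "I \<in> multi_indices n d"
  shows "tensor_act n d (\<lambda>i. 1\<^sub>m n) u I = u I"
  using tensor_act_mat_diag[OF assms, of "\<lambda>_ _. 1" u] by simp

text \<open>By symmetry of \<open>v\<close>, the defining sum may be reindexed along
  \<open>J \<circ> \<pi>\<close> without changing the coefficients; reindexing the product then
  moves the permutation from the matrices to the output index.\<close>

lemma tensor_act_permute:
  assumes \<pi>: "\<pi> permutes {..<d}" and v: "v \<in> symmetric_tensors n d"
  shows "tensor_act n d (h \<circ> \<pi>) v I = tensor_act n d h v (I \<circ> inv_into UNIV \<pi>)"
proof -
  have \<pi>': "inv_into UNIV \<pi> permutes {..<d}" using \<pi> by (rule permutes_inv)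
  have id: "\<pi> \<circ> inv_into UNIV \<pi> = id" "inv_into UNIV \<pi> \<circ> \<pi> = id"
    using permutes_inv_o[OF \<pi>] by auto
  have bij: "bij_betw (\<lambda>J. J \<circ> \<pi>) (multi_indices n d) (multi_indices n d)"
  proof (rule bij_betw_byWitness[where f' = "\<lambda>J. J \<circ> inv_into UNIV \<pi>"])
    show "\<forall>J\<in>multi_indices n d. J \<circ> \<pi> \<circ> inv_into UNIV \<pi> = J" "\<forall>J\<in>multi_indices n d. J \<circ> inv_into UNIV \<pi> \<circ> \<pi> = J"
      by (simp_all add: comp_assoc id)
  qed (use multi_indices_comp_permutes[OF \<pi>] multi_indices_comp_permutes[OF \<pi>'] in auto)
  have eq: "(\<Prod>i<d. (h \<circ> \<pi>) i $$ (I i, (J \<circ> \<pi>) i)) = (\<Prod>i<d. h i $$ ((I \<circ> inv_into UNIV \<pi>) i, J i))" for J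
    using prod.permute[OF \<pi>, of "\<lambda>i. h i $$ ((I \<circ> inv_into UNIV \<pi>) i, J i)"] permutes_inverses(2)[OF \<pi>]
    by (simp add: comp_def)
  have "tensor_act n d (h \<circ> \<pi>) v I =
      (\<Sum>J\<in>multi_indices n d. (\<Prod>i<d. (h \<circ> \<pi>) i $$ (I i, (J \<circ> \<pi>) i)) * v (J \<circ> \<pi>))"
    unfolding tensor_act_def by (rule sum.reindex_bij_betw[OF bij, symmetric])
  also have "\<dots> = tensor_act n d h v (I \<circ> inv_into UNIV \<pi>)"
    unfolding eq tensor_act_def
    using v \<pi> by (intro sum.cong refl) (auto simp: symmetric_tensors_def)
  finally show ?thesis .
qed

section \<open>Weighted bases and the weight of a tensor\<close>

text \<open>The rows of \<open>h i\<close> are linear forms, and the \<open>j\<close>-th one carries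
  the weight \<open>a i j\<close>. For invertible \<open>h i\<close> the tested values are the
  coordinates of \<open>v\<close> in the dual bases, so \<open>v\<close> lies in step
  \<open>m\<close> of the tensor product of the weight filtrations.\<close>

definition weight_ge ::
    "nat \<Rightarrow> nat \<Rightarrow> (nat \<Rightarrow> 'k::field mat) \<Rightarrow> (nat \<Rightarrow> nat \<Rightarrow> nat) \<Rightarrow> nat \<Rightarrow> ((nat \<Rightarrow> nat) \<Rightarrow> 'k) \<Rightarrow> bool" where
  "weight_ge n d h a m v \<longleftrightarrow>
     (\<forall>I\<in>multi_indices n d. tensor_act n d h v I \<noteq> 0 \<longrightarrow> m \<le> (\<Sum>i<d. a i (I i)))"

text \<open>Row \<open>j\<close> of \<open>P * h\<close>, given weight \<open>a j\<close>, then
  involves only rows of \<open>h\<close> of \<open>b\<close>-weight at most \<open>a j\<close>. This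
  is a containment of flags of linear forms, written in coordinates.\<close>

definition raises_weight :: "nat \<Rightarrow> (nat \<Rightarrow> nat) \<Rightarrow> (nat \<Rightarrow> nat) \<Rightarrow> 'k::field mat \<Rightarrow> bool" where
  "raises_weight n a b P \<longleftrightarrow> (\<forall>j<n. \<forall>k<n. P $$ (j, k) \<noteq> 0 \<longrightarrow> b k \<le> a j)"

lemma raises_weight_mult:
  assumes "raises_weight n a b P" "raises_weight n b c Q" "P \<in> carrier_mat n n" "Q \<in> carrier_mat n n"
  shows "raises_weight n a c (P * Q)"
  unfolding raises_weight_def
proof (intro allI impI)
  fix j k assume jk: "j < n" "k < n" "(P * Q) $$ (j, k) \<noteq> 0"
  have "(\<Sum>l<n. P $$ (j, l) * Q $$ (l, k)) \<noteq> 0"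
    using jk(3) mult_mat_entry[OF assms(3,4) jk(1,2)] by simp
  from sum.not_neutral_contains_not_neutral[OF this]
  obtain l where l: "l < n" "P $$ (j, l) \<noteq> 0" "Q $$ (l, k) \<noteq> 0" by auto
  then have "c k \<le> b l" "b l \<le> a j"
    using assms(1,2) jk(1,2) by (auto simp: raises_weight_def)
  then show "c k \<le> a j" by simp
qed

lemma raises_weight_one: "raises_weight n a a (1\<^sub>m n)"
  by (auto simp: raises_weight_def)

text \<open>A nonzero new coordinate at \<open>I\<close> comes from a nonzero old one at some
  \<open>J\<close> with \<open>P i $$ (I i, J i)\<close> nonzero in every position, so the weight
  does not drop in any factor.\<close>

lemma weight_ge_mult:
  assumes P: "\<And>i. i < d \<Longrightarrow> P i \<in> carrier_mat n n" and h: "\<And>i. i < d \<Longrightarrow> h i \<in> carrier_mat n n"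
    and r: "\<And>i. i < d \<Longrightarrow> raises_weight n (a' i) (a i) (P i)"
    and w: "weight_ge n d h a m v"
  shows "weight_ge n d (\<lambda>i. P i * h i) a' m v"
  unfolding weight_ge_def
proof (intro ballI impI)
  fix I assume I: "I \<in> multi_indices n d" and nz: "tensor_act n d (\<lambda>i. P i * h i) v I \<noteq> 0"
  have "tensor_act n d P (tensor_act n d h v) I \<noteq> 0"
    using nz tensor_act_mult[of d P n h I v] P h I by simp
  from sum.not_neutral_contains_not_neutral[OF this[unfolded tensor_act_def[of n d P]]]
  obtain J where J: "J \<in> multi_indices n d"
    and nz': "(\<Prod>i<d. P i $$ (I i, J i)) * tensor_act n d h v J \<noteq> 0" by auto
  have "m \<le> (\<Sum>i<d. a i (J i))" using w J nz' by (auto simp: weight_ge_def)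
  also have "\<dots> \<le> (\<Sum>i<d. a' i (I i))"
  proof (rule sum_mono)
    fix i assume i: "i \<in> {..<d}"
    have "P i $$ (I i, J i) \<noteq> 0" using nz' i by auto
    then show "a i (J i) \<le> a' i (I i)"
      using r[of i] i multi_indicesD[OF I, of i] multi_indicesD[OF J, of i]
      by (auto simp: raises_weight_def)
  qed
  finally show "m \<le> (\<Sum>i<d. a' i (I i))" .
qed

lemma weight_ge_permute:
  assumes \<pi>: "\<pi> permutes {..<d}" and v: "v \<in> symmetric_tensors n d" and w: "weight_ge n d h a m v"
  shows "weight_ge n d (h \<circ> \<pi>) (a \<circ> \<pi>) m v"
  unfolding weight_ge_def
proof (intro ballI impI)
  fix I assume I: "I \<in> multi_indices n d" and nz: "tensor_act n d (h \<circ> \<pi>) v I \<noteq> 0"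
  have "m \<le> (\<Sum>i<d. a i ((I \<circ> inv_into UNIV \<pi>) i))"
    using w nz multi_indices_comp_permutes[OF permutes_inv[OF \<pi>] I] tensor_act_permute[OF \<pi> v]
    unfolding weight_ge_def by auto
  also have "\<dots> = (\<Sum>i<d. (a \<circ> \<pi>) i (I i))"
    using sum.permute[OF \<pi>, of "\<lambda>i. a i ((I \<circ> inv_into UNIV \<pi>) i)"] permutes_inverses(2)[OF \<pi>]
    by (simp add: comp_def)
  finally show "m \<le> (\<Sum>i<d. (a \<circ> \<pi>) i (I i))" .
qed

lemma weight_ge_cong:
  assumes "\<And>i. i < d \<Longrightarrow> h i = h' i" "\<And>i. i < d \<Longrightarrow> a i = a' i"
  shows "weight_ge n d h a m v \<longleftrightarrow> weight_ge n d h' a' m v"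
proof -
  have "tensor_act n d h v I = tensor_act n d h' v I" for I
    by (rule tensor_act_cong) (use assms(1) in auto)
  moreover have "(\<Sum>i<d. a i (I i)) = (\<Sum>i<d. a' i (I i))" for I
    by (rule sum.cong) (use assms(2) in auto)
  ultimately show ?thesis by (simp add: weight_ge_def)
qed

section \<open>Common adapted bases\<close>

text \<open>Some term of the Leibniz expansion is nonzero.\<close>

lemma det_nonzero_imp_permutation:
  assumes "Z \<in> carrier_mat n n" "det Z \<noteq> (0::'a::idom)"
  obtains p where "p permutes {0..<n}" "\<And>i. i < n \<Longrightarrow> Z $$ (i, p i) \<noteq> 0"
proof -
  have "(\<Sum>p | p permutes {0..<n}. signof p * (\<Prod>i = 0..<n. Z $$ (i, p i))) \<noteq> 0"
    using assms by (simp add: det_def')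
  from sum.not_neutral_contains_not_neutral[OF this]
  obtain p where p: "p permutes {0..<n}" "signof p * (\<Prod>i = 0..<n. Z $$ (i, p i)) \<noteq> 0" by blast
  have "Z $$ (i, p i) \<noteq> 0" if "i < n" for i using p(2) that by auto
  then show ?thesis using that p(1) by blast
qed

text \<open>Two flags have a common adapted basis. Here a basis of linear forms is adapted to the second
  flag once \<open>sum b'\<close> is minimal: otherwise the leading parts of the rows are dependent, and the
  row of largest \<open>a\<close>-weight in a dependency can be replaced by one of smaller \<open>b\<close>-weight.\<close>

lemma exists_common_adapted_basis:
  fixes X :: "'k::field mat"
  assumes X: "X \<in> carrier_mat n n" and dX: "det X \<noteq> 0"
  obtains H b' where "H \<in> carrier_mat n n" "det H \<noteq> 0" "raises_weight n a a H"
    "raises_weight n b' b (H * X)" "(\<Sum>j<n. b' j) = (\<Sum>j<n. b j)"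
proof -
  define Q where "Q s \<longleftrightarrow> (\<exists>H b'. H \<in> carrier_mat n n \<and> det H \<noteq> 0 \<and> raises_weight n a a H \<and>
      raises_weight n b' b (H * X) \<and> (\<Sum>j<n. b' j) = s)" for s :: nat
  \<comment> \<open>Some sum is attainable: for \<open>H\<close> the identity, the constant weight
    \<open>\<Sum>k<n. b k\<close> dominates every \<open>b k\<close>.\<close>
  have "Q (\<Sum>j<n. (\<Sum>k<n. b k))"
    unfolding Q_def
    by (intro exI[of _ "1\<^sub>m n"] exI[of _ "\<lambda>_. \<Sum>k<n. b k"])
       (auto simp: raises_weight_def X intro: member_le_sum)
  then have Q: "Q (LEAST s. Q s)" by (rule LeastI)
  have least: "(LEAST s. Q s) \<le> s" if "Q s" for s using that by (rule Least_le)
  obtain H b' where H: "H \<in> carrier_mat n n" "det H \<noteq> 0" "raises_weight n a a H"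
    and b': "raises_weight n b' b (H * X)" and s: "(\<Sum>j<n. b' j) = (LEAST s. Q s)"
    using Q unfolding Q_def by blast
  define Y where "Y = H * X"
  have Y: "Y \<in> carrier_mat n n" using H X by (simp add: Y_def)
  have dY: "det Y \<noteq> 0" using det_mult[OF H(1) X] H(2) dX by (simp add: Y_def)
  have Y_le: "b k \<le> b' j" if "j < n" "k < n" "Y $$ (j, k) \<noteq> 0" for j k
    using b' that by (auto simp: raises_weight_def Y_def)
  \<comment> \<open>\<open>Z\<close> holds the leading parts of the rows of \<open>Y\<close>, the
    entries where the bound \<open>b k \<le> b' j\<close> is attained.\<close>
  define Z where "Z = mat n n (\<lambda>(j, k). if b k = b' j then Y $$ (j, k) else 0)"
  have Z: "Z \<in> carrier_mat n n" by (simp add: Z_def)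
  have "det Z \<noteq> 0"
  proof
    assume "det Z = 0"
    then have "det (transpose_mat Z) = 0" using det_transpose[OF Z] by simp
    then obtain v where v: "v \<in> carrier_vec n" "v \<noteq> 0\<^sub>v n" "transpose_mat Z *\<^sub>v v = 0\<^sub>v n"
      using det_0_iff_vec_prod_zero[of "transpose_mat Z" n] Z by auto
    have dep: "(\<Sum>j<n. Z $$ (j, k) * v $ j) = 0" if k: "k < n" for k
    proof -
      have "(transpose_mat Z *\<^sub>v v) $ k = (\<Sum>j<n. Z $$ (j, k) * v $ j)"
        using v(1) Z k by (auto simp: scalar_prod_def atLeast0LessThan intro!: sum.cong)
      then show ?thesis using v(3) k by simp
    qed
    obtain j1 where j1: "j1 < n" "v $ j1 \<noteq> 0"
      using v(1,2) by (metis carrier_vecD eq_vecI index_zero_vec)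
    \<comment> \<open>Column \<open>k\<close> of \<open>Z\<close> involves only rows with
      \<open>b' j = b k\<close>, so the dependency splits according to the values of
      \<open>b'\<close>. One class \<open>J\<close> with nonzero coefficients is kept.\<close>
    define c where "c = b' j1"
    define J where "J = {j. j < n \<and> v $ j \<noteq> 0 \<and> b' j = c}"
    have J: "finite J" "j1 \<in> J" using j1 by (auto simp: J_def c_def)
    have "Max (a ` J) \<in> a ` J" using J by (intro Max_in) auto
    then obtain j0 where j0: "j0 \<in> J" and "a j0 = Max (a ` J)" by auto
    then have j0_max: "a j \<le> a j0" if "j \<in> J" for j using J(1) that by simp
    have j0n: "j0 < n" "v $ j0 \<noteq> 0" "b' j0 = c" using j0 by (auto simp: J_def)
    \<comment> \<open>\<open>E\<close> replaces row \<open>j0\<close> by the combination of the rows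
      in \<open>J\<close> given by the dependency. It is invertible because \<open>v $ j0\<close> is
      nonzero, and it respects the \<open>a\<close>-flag because \<open>a j0\<close> is maximal on
      \<open>J\<close>.\<close>
    define E where "E = mat n n (\<lambda>(i, j). if i = j0 then (if j \<in> J then v $ j else 0)
        else if i = j then 1 else 0)"
    have E: "E \<in> carrier_mat n n" by (simp add: E_def)
    have dE: "det E \<noteq> 0"
    proof
      assume "det E = 0"
      then obtain w where w: "w \<in> carrier_vec n" "w \<noteq> 0\<^sub>v n" "E *\<^sub>v w = 0\<^sub>v n"
        using det_0_iff_vec_prod_zero[OF E] by auto
      have Ew: "(\<Sum>j<n. E $$ (i, j) * w $ j) = 0" if i: "i < n" for i
      proof -
        have "(E *\<^sub>v w) $ i = (\<Sum>j<n. E $$ (i, j) * w $ j)"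
          using w(1) E i by (auto simp: scalar_prod_def atLeast0LessThan intro!: sum.cong)
        then show ?thesis using w(3) i by simp
      qed
      have w0: "w $ i = 0" if i: "i < n" "i \<noteq> j0" for i
      proof -
        have "(\<Sum>j<n. E $$ (i, j) * w $ j) = (\<Sum>j<n. if j = i then w $ j else 0)"
          using i by (intro sum.cong refl) (auto simp: E_def)
        also have "\<dots> = w $ i" using i by simp
        finally show ?thesis using Ew[OF i(1)] by simp
      qed
      have "(\<Sum>j<n. E $$ (j0, j) * w $ j) = (\<Sum>j<n. if j = j0 then v $ j * w $ j else 0)"
        using j0 j0n w0 by (intro sum.cong refl) (auto simp: E_def)
      also have "\<dots> = v $ j0 * w $ j0" using j0n by simp
      finally have "w $ j0 = 0" using Ew[OF j0n(1)] j0n by simp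
      then have "w $ i = 0" if "i < n" for i using w0[of i] that by (cases "i = j0") auto
      then have "w = 0\<^sub>v n" using w(1) by (intro eq_vecI) auto
      then show False using w(2) by simp
    qed
    have EY: "E * Y \<in> carrier_mat n n" using E Y by simp
    have EY_row: "(E * Y) $$ (i, k) = Y $$ (i, k)" if "i < n" "i \<noteq> j0" "k < n" for i k
    proof -
      have "(E * Y) $$ (i, k) = (\<Sum>j<n. if j = i then Y $$ (j, k) else 0)"
        unfolding mult_mat_entry[OF E Y that(1,3)] using that
        by (intro sum.cong refl) (auto simp: E_def)
      then show ?thesis using that by simp
    qed
    \<comment> \<open>In the columns with \<open>b k = c\<close> the combination vanishes by the
      dependency, so the bound becomes strict.\<close>
    have EY_j0: "b k < c" if k: "k < n" "(E * Y) $$ (j0, k) \<noteq> 0" for k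
    proof -
      have eq: "(E * Y) $$ (j0, k) = (\<Sum>j<n. if j \<in> J then v $ j * Y $$ (j, k) else 0)"
        unfolding mult_mat_entry[OF E Y j0n(1) k(1)] using j0n
        by (intro sum.cong refl) (auto simp: E_def)
      then have "\<exists>j<n. (if j \<in> J then v $ j * Y $$ (j, k) else 0) \<noteq> 0"
        using k(2) by (intro ccontr[of "\<exists>j<n. _ j"]) simp
      then obtain j where j: "j < n" "(if j \<in> J then v $ j * Y $$ (j, k) else 0) \<noteq> 0"
        by blast
      then have "j \<in> J" "Y $$ (j, k) \<noteq> 0" by (simp_all split: if_splits)
      then have le: "b k \<le> c" using Y_le[of j k] k by (auto simp: J_def)
      moreover have "b k \<noteq> c"
      proof
        assume bk: "b k = c"
        have "(\<Sum>j<n. if j \<in> J then v $ j * Y $$ (j, k) else 0) = (\<Sum>j<n. Z $$ (j, k) * v $ j)"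
          using bk k by (intro sum.cong refl) (auto simp: Z_def J_def)
        then show False using dep[OF k(1)] eq k(2) by simp
      qed
      ultimately show ?thesis by simp
    qed
    \<comment> \<open>Row \<open>j0\<close> of an invertible matrix has a nonzero entry, which
      forces \<open>c > 0\<close>; hence \<open>c - 1\<close> is a true decrease on
      naturals.\<close>
    have "det (E * Y) \<noteq> 0" using det_mult[OF E Y] dE dY by simp
    then obtain p where p: "p permutes {0..<n}" "\<And>i. i < n \<Longrightarrow> (E * Y) $$ (i, p i) \<noteq> 0"
      using det_nonzero_imp_permutation[OF EY] by metis
    have "p j0 < n" using permutes_in_image[OF p(1), of j0] j0n by simp
    then have c: "c > 0" using EY_j0[of "p j0"] p(2)[OF j0n(1)] by simp
    define b'' where "b'' = b'(j0 := c - 1)"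
    have "raises_weight n b'' b (E * Y)"
      using EY_row EY_j0 Y_le c by (fastforce simp: raises_weight_def b''_def)
    then have "raises_weight n b'' b (E * H * X)" using E H X by (simp add: Y_def)
    moreover have "raises_weight n a a E"
      using j0_max by (auto simp: raises_weight_def E_def split: if_splits)
    then have "raises_weight n a a (E * H)"
      using H E by (intro raises_weight_mult) auto
    moreover have "E * H \<in> carrier_mat n n" "det (E * H) \<noteq> 0"
      using E H dE det_mult[OF E H(1)] by auto
    ultimately have "Q (\<Sum>j<n. b'' j)" unfolding Q_def by blast
    moreover have "(\<Sum>j<n. b'' j) < (\<Sum>j<n. b' j)"
      by (rule sum_strict_mono_ex1) (use c j0n in \<open>auto simp: b''_def intro!: bexI[of _ j0]\<close>)
    ultimately show False using least[of "\<Sum>j<n. b'' j"] s by simp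
  qed
  \<comment> \<open>A nonzero Leibniz term of \<open>Z\<close> matches each row \<open>i\<close>
    with a column \<open>p i\<close> where the bound is attained, so \<open>b'\<close> is a
    rearrangement of \<open>b\<close>.\<close>
  then obtain p where p: "p permutes {0..<n}" "\<And>i. i < n \<Longrightarrow> Z $$ (i, p i) \<noteq> 0"
    using det_nonzero_imp_permutation[OF Z] by metis
  have p_lt: "p i < n" if "i < n" for i using permutes_in_image[OF p(1), of i] that by simp
  have "b' i = b (p i)" if "i < n" for i
    using p(2)[OF that] that p_lt[OF that] by (auto simp: Z_def split: if_splits)
  then have "(\<Sum>j<n. b' j) = (\<Sum>j<n. b (p j))" by simp
  also have "\<dots> = (\<Sum>j<n. b j)"
    using sum.permute[OF p(1), of b] by (simp add: atLeast0LessThan comp_def)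
  finally show ?thesis using that H b' by blast
qed

section \<open>Equalising the flags\<close>

lemma obtain_inverse_mat:
  fixes A :: "'k::field mat"
  assumes "A \<in> carrier_mat n n" "det A \<noteq> 0"
  obtains B where "B \<in> carrier_mat n n" "A * B = 1\<^sub>m n" "B * A = 1\<^sub>m n"
  using det_non_zero_imp_unit[OF assms, of "()"] by (auto simp: Units_def ring_mat_def)

text \<open>For a fixed tuple of bases the same coordinates are tested for every weight family, so
  the lower bounds can be added.\<close>

lemma weight_ge_sum:
  assumes "\<And>s. s \<in> S \<Longrightarrow> weight_ge n d h (\<alpha> s) m v"
  shows "weight_ge n d h (\<lambda>i j. \<Sum>s\<in>S. \<alpha> s i j) (card S * m) v"
  unfolding weight_ge_def
proof (intro ballI impI)
  fix I assume I: "I \<in> multi_indices n d" "tensor_act n d h v I \<noteq> 0"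
  have "card S * m = (\<Sum>s\<in>S. m)" by simp
  also have "\<dots> \<le> (\<Sum>s\<in>S. \<Sum>i<d. \<alpha> s i (I i))"
    using assms I by (intro sum_mono) (auto simp: weight_ge_def)
  also have "\<dots> = (\<Sum>i<d. \<Sum>s\<in>S. \<alpha> s i (I i))" by (rule sum.swap)
  finally show "card S * m \<le> (\<Sum>i<d. \<Sum>s\<in>S. \<alpha> s i (I i))" .
qed

text \<open>The \<open>k\<close> equal flags and the flag in position \<open>k\<close> lie in one apartment, where the weights of the
  \<open>k + 1\<close> tuples obtained by moving the odd flag into each position \<open>s \<le> k\<close> can be added up.\<close>

lemma weight_ge_equalize_step:
  fixes v :: "(nat \<Rightarrow> nat) \<Rightarrow> 'k::field"
  assumes v: "v \<in> symmetric_tensors n d" and k: "k < d"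
    and h: "\<And>i. i < d \<Longrightarrow> h i \<in> carrier_mat n n" "\<And>i. i < d \<Longrightarrow> det (h i) \<noteq> 0"
    and eq: "\<And>i. i < k \<Longrightarrow> h i = A" "\<And>i. i < k \<Longrightarrow> a i = \<alpha>"
    and A: "A \<in> carrier_mat n n" "det A \<noteq> 0"
    and w: "weight_ge n d h a m v"
  obtains h' a' A' \<alpha>' where "\<And>i. i < d \<Longrightarrow> h' i \<in> carrier_mat n n" "\<And>i. i < d \<Longrightarrow> det (h' i) \<noteq> 0"
    "\<And>i. i < Suc k \<Longrightarrow> h' i = A'" "\<And>i. i < Suc k \<Longrightarrow> a' i = \<alpha>'"
    "A' \<in> carrier_mat n n" "det A' \<noteq> 0"
    "weight_ge n d h' a' (Suc k * m) v"
    "(\<Sum>i<d. \<Sum>j<n. a' i j) = Suc k * (\<Sum>i<d. \<Sum>j<n. a i j)"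
proof -
  define B where "B = h k"
  have B: "B \<in> carrier_mat n n" "det B \<noteq> 0" using h k by (auto simp: B_def)
  obtain B' where B': "B' \<in> carrier_mat n n" "B * B' = 1\<^sub>m n" "B' * B = 1\<^sub>m n"
    using obtain_inverse_mat[OF B] by blast
  \<comment> \<open>Since \<open>A = X * B\<close>, the matrix \<open>X\<close> relates the two
    bases of forms. The resulting basis \<open>H * A\<close> is adapted to the flag of
    \<open>A\<close> with weights \<open>\<alpha>\<close> and to that of \<open>B\<close> with
    weights \<open>b\<close>.\<close>
  define X where "X = A * B'"
  have X: "X \<in> carrier_mat n n" using A B' by (simp add: X_def)
  have "det B' \<noteq> 0" using det_mult[OF B(1) B'(1)] B'(2) by auto
  then have "det X \<noteq> 0" using det_mult[OF A(1) B'(1)] A(2) by (simp add: X_def)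
  then obtain H b where H: "H \<in> carrier_mat n n" "det H \<noteq> 0" "raises_weight n \<alpha> \<alpha> H"
    and b: "raises_weight n b (a k) (H * X)" "(\<Sum>j<n. b j) = (\<Sum>j<n. a k j)"
    using exists_common_adapted_basis[OF X, of \<alpha> "a k"] by metis
  have HXB: "H * X * B = H * A"
  proof -
    have "H * X * B = H * (X * B)" by (rule assoc_mult_mat[OF H(1) X B(1)])
    also have "X * B = A * (B' * B)" unfolding X_def by (rule assoc_mult_mat[OF A(1) B'(1) B(1)])
    finally show ?thesis using A(1) B'(3) by simp
  qed
  define h' where "h' i = (if i \<le> k then H * A else h i)" for i
  \<comment> \<open>\<open>\<beta> s\<close> is the weight family with the odd flag in position
    \<open>s\<close>, expressed in the common basis.\<close>
  define \<beta> where "\<beta> s i = (if i \<le> k then if i = s then b else \<alpha> else a i)" for s i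
  have perm: "transpose s k permutes {..<d}" if "s \<le> k" for s
    using that k by (intro permutes_swap_id) auto
  have \<beta>_weight: "weight_ge n d h' (\<beta> s) m v" if s: "s \<le> k" for s
  proof -
    \<comment> \<open>\<open>P\<close> carries the transposed tuple to \<open>h'\<close>; in
      position \<open>s\<close> this is the identity \<open>H * X * B = H * A\<close>.\<close>
    define P where "P i = (if i \<le> k then if i = s then H * X else H else 1\<^sub>m n)" for i
    have at: "h (transpose s k i) = (if i \<le> k then if i = s then B else A else h i)"
        "a (transpose s k i) = (if i \<le> k then if i = s then a k else \<alpha> else a i)" for i
      using s eq by (auto simp: transpose_def B_def)
    have "weight_ge n d (\<lambda>i. P i * (h \<circ> transpose s k) i) (\<beta> s) m v"
    proof (rule weight_ge_mult)
      show "weight_ge n d (h \<circ> transpose s k) (a \<circ> transpose s k) m v"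
        by (rule weight_ge_permute[OF perm[OF s] v w])
      show "P i \<in> carrier_mat n n" if "i < d" for i using H X by (simp add: P_def)
      show "(h \<circ> transpose s k) i \<in> carrier_mat n n" if "i < d" for i
        using h A B that by (simp add: at)
      show "raises_weight n (\<beta> s i) ((a \<circ> transpose s k) i) (P i)" if "i < d" for i
        using H(3) b(1) by (simp add: at \<beta>_def P_def raises_weight_one)
    qed
    moreover have "P i * (h \<circ> transpose s k) i = h' i" if "i < d" for i
      using HXB s left_mult_one_mat[OF h(1)[OF that]] by (auto simp: P_def at h'_def)
    ultimately show ?thesis
      using weight_ge_cong[of d "\<lambda>i. P i * (h \<circ> transpose s k) i" h' "\<beta> s" "\<beta> s"] by simp
  qed
  define a' where "a' i j = (\<Sum>s\<le>k. \<beta> s i j)" for i j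
  show ?thesis
  proof
    show "weight_ge n d h' a' (Suc k * m) v"
      using weight_ge_sum[of "{..k}" n d h' \<beta> m v] \<beta>_weight by (simp add: a'_def[abs_def])
    show "h' i = H * A" if "i < Suc k" for i using that by (simp add: h'_def)
    show HA: "H * A \<in> carrier_mat n n" "det (H * A) \<noteq> 0"
      using H A det_mult[OF H(1) A(1)] by auto
    show "h' i \<in> carrier_mat n n" "det (h' i) \<noteq> 0" if "i < d" for i
      using HA h that by (auto simp: h'_def)
    \<comment> \<open>Among the \<open>k + 1\<close> placements exactly one puts the odd flag in
      position \<open>i\<close>, so the result is the same for all these positions.\<close>
    show "a' i = (\<lambda>j. b j + k * \<alpha> j)" if i: "i < Suc k" for i
    proof
      fix j
      have "a' i j = \<beta> i i j + (\<Sum>s\<in>{..k} - {i}. \<beta> s i j)"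
        unfolding a'_def using i by (intro sum.remove) auto
      also have "(\<Sum>s\<in>{..k} - {i}. \<beta> s i j) = (\<Sum>s\<in>{..k} - {i}. \<alpha> j)"
        using i by (intro sum.cong) (auto simp: \<beta>_def)
      finally show "a' i j = b j + k * \<alpha> j" using i by (simp add: \<beta>_def)
    qed
    \<comment> \<open>Each placement keeps the total weight, because \<open>b\<close> and
      \<open>a k\<close> have equal sums and transposing positions only reorders the
      summands.\<close>
    have "(\<Sum>i<d. \<Sum>j<n. \<beta> s i j) = (\<Sum>i<d. \<Sum>j<n. a i j)" if s: "s \<le> k" for s
    proof -
      have "(\<Sum>i<d. \<Sum>j<n. \<beta> s i j) = (\<Sum>i<d. \<Sum>j<n. a (transpose s k i) j)"
        using s eq b(2) by (intro sum.cong[OF refl, of "{..<d}"]) (auto simp: \<beta>_def transpose_def)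
      also have "\<dots> = (\<Sum>i<d. \<Sum>j<n. a i j)"
        using sum.permute[OF perm[OF s], of "\<lambda>i. \<Sum>j<n. a i j"] by (simp add: comp_def)
      finally show ?thesis .
    qed
    moreover have "(\<Sum>i<d. \<Sum>j<n. a' i j) = (\<Sum>i<d. \<Sum>s\<le>k. \<Sum>j<n. \<beta> s i j)"
      unfolding a'_def by (intro sum.cong[OF refl] sum.swap)
    moreover have "\<dots> = (\<Sum>s\<le>k. \<Sum>i<d. \<Sum>j<n. \<beta> s i j)" by (rule sum.swap)
    ultimately show "(\<Sum>i<d. \<Sum>j<n. a' i j) = Suc k * (\<Sum>i<d. \<Sum>j<n. a i j)" by simp
  qed
qed

text \<open>Induction on the number \<open>k\<close> of leading positions that agree. The factor
  \<open>N\<close> collects the factors \<open>Suc k\<close> of the single steps and scales the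
  bound and the total weight alike.\<close>

lemma weight_ge_equalize:
  fixes v :: "(nat \<Rightarrow> nat) \<Rightarrow> 'k::field"
  assumes v: "v \<in> symmetric_tensors n d" and d: "d \<ge> 1"
    and h: "\<And>i. i < d \<Longrightarrow> h i \<in> carrier_mat n n" "\<And>i. i < d \<Longrightarrow> det (h i) \<noteq> 0"
    and w: "weight_ge n d h a m v"
  obtains g c N where "g \<in> carrier_mat n n" "det g \<noteq> 0" "N > (0::nat)"
    "weight_ge n d (\<lambda>_. g) (\<lambda>_. c) (N * m) v"
    "d * (\<Sum>j<n. c j) = N * (\<Sum>i<d. \<Sum>j<n. a i j)"
proof -
  have "\<exists>h' a' A \<alpha> N. (\<forall>i<d. h' i \<in> carrier_mat n n \<and> det (h' i) \<noteq> 0) \<and>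
      (\<forall>i<k. h' i = A \<and> a' i = \<alpha>) \<and> A \<in> carrier_mat n n \<and> det A \<noteq> 0 \<and> N > 0 \<and>
      weight_ge n d h' a' (N * m) v \<and> (\<Sum>i<d. \<Sum>j<n. a' i j) = N * (\<Sum>i<d. \<Sum>j<n. a i j)"
    if "k \<le> d" for k
    using that
  proof (induction k)
    case 0
    \<comment> \<open>For \<open>k = 0\<close> the agreement is vacuous; \<open>h 0\<close> merely
      supplies an invertible matrix, available since \<open>d \<ge> 1\<close>.\<close>
    show ?case using h w d
      by (intro exI[of _ h] exI[of _ a] exI[of _ "h 0"] exI[of _ "a 0"] exI[of _ 1]) auto
  next
    case (Suc k)
    then obtain h' a' A \<alpha> N where IH: "\<forall>i<d. h' i \<in> carrier_mat n n \<and> det (h' i) \<noteq> 0"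
      "\<forall>i<k. h' i = A \<and> a' i = \<alpha>" "A \<in> carrier_mat n n" "det A \<noteq> 0" "N > 0"
      "weight_ge n d h' a' (N * m) v" "(\<Sum>i<d. \<Sum>j<n. a' i j) = N * (\<Sum>i<d. \<Sum>j<n. a i j)"
      by (metis Suc_leD)
    have "k < d" using Suc.prems by simp
    then show ?case
    proof (rule weight_ge_equalize_step[OF v _ _ _ _ _ IH(3,4,6)])
      fix h'' a'' A'' \<alpha>''
      assume "\<And>i. i < d \<Longrightarrow> h'' i \<in> carrier_mat n n" "\<And>i. i < d \<Longrightarrow> det (h'' i) \<noteq> 0"
        "\<And>i. i < Suc k \<Longrightarrow> h'' i = A''" "\<And>i. i < Suc k \<Longrightarrow> a'' i = \<alpha>''"
        "A'' \<in> carrier_mat n n" "det A'' \<noteq> 0"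
        "weight_ge n d h'' a'' (Suc k * (N * m)) v"
        "(\<Sum>i<d. \<Sum>j<n. a'' i j) = Suc k * (\<Sum>i<d. \<Sum>j<n. a' i j)"
      then show ?case using IH(5,7)
        by (intro exI[of _ h''] exI[of _ a''] exI[of _ A''] exI[of _ \<alpha>''] exI[of _ "Suc k * N"])
           (simp add: algebra_simps)
    qed (use IH in auto)
  qed
  from this[OF order.refl] obtain h' a' A \<alpha> N where
    *: "\<forall>i<d. h' i = A \<and> a' i = \<alpha>" "A \<in> carrier_mat n n" "det A \<noteq> 0" "N > 0"
      "weight_ge n d h' a' (N * m) v" "(\<Sum>i<d. \<Sum>j<n. a' i j) = N * (\<Sum>i<d. \<Sum>j<n. a i j)"
    by blast
  have "weight_ge n d (\<lambda>_. A) (\<lambda>_. \<alpha>) (N * m) v"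
    using *(1,5) weight_ge_cong[of d h' "\<lambda>_. A" a' "\<lambda>_. \<alpha>"] by simp
  moreover have "d * (\<Sum>j<n. \<alpha> j) = N * (\<Sum>i<d. \<Sum>j<n. a i j)" using *(1,6) by simp
  ultimately show ?thesis using that *(2-4) by blast
qed

section \<open>Diagonal 1-parameter subgroups\<close>

interpretation fls_const: comm_ring_hom "fls_const :: 'a::comm_ring_1 \<Rightarrow> 'a fls"
  by unfold_locales (simp_all add: fls_plus_const)

text \<open>Here \<open>h\<close> stands for the inverse of \<open>g\<close>. It is a separate
  argument because its rows are the eigenforms that enter \<open>weight_ge\<close>.\<close>

definition conj_1ps :: "nat \<Rightarrow> 'k::field mat \<Rightarrow> (nat \<Rightarrow> int) \<Rightarrow> 'k mat \<Rightarrow> 'k fls mat" where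
  "conj_1ps n g e h = map_mat fls_const g * mat_diag n (\<lambda>k. fls_X powi e k) * map_mat fls_const h"

lemma conj_mat_diag_entry:
  assumes "G \<in> carrier_mat n n" "H \<in> carrier_mat n n" "i < n" "j < n"
  shows "(G * mat_diag n D * H) $$ (i, j) = (\<Sum>k<n. G $$ (i, k) * D k * H $$ (k, j))"
proof -
  have "G * mat_diag n D = mat n n (\<lambda>(i, j). G $$ (i, j) * D j)"
    using assms(1) by (rule mat_diag_mult_right)
  then show ?thesis using assms
    by (subst mult_mat_entry[of _ n]) auto
qed

text \<open>Stated over a general commutative ring, as it serves over \<open>K((t))\<close> for
  inverses and over \<open>K((t))((s))\<close> for the group law.\<close>

lemma conj_mat_diag_mult:
  fixes G H :: "'a::comm_ring_1 mat"
  assumes G: "G \<in> carrier_mat n n" and H: "H \<in> carrier_mat n n" and HG: "H * G = 1\<^sub>m n"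
  shows "G * mat_diag n D * H * (G * mat_diag n D' * H) = G * mat_diag n (\<lambda>k. D k * D' k) * H"
proof -
  have D'H: "mat_diag n D' * H \<in> carrier_mat n n" and GD: "G * mat_diag n D \<in> carrier_mat n n"
    and GD'H: "G * mat_diag n D' * H \<in> carrier_mat n n"
    using G H by (auto intro!: mult_carrier_mat[of _ n n])
  note c = G H mat_diag_dim[of n D] mat_diag_dim[of n D'] D'H GD GD'H
  have "G * mat_diag n D * H * (G * mat_diag n D' * H) =
      G * mat_diag n D * (H * (G * mat_diag n D' * H))"
    by (rule assoc_mult_mat[of _ n n _ n _ n]) (use c in simp_all)
  also have "H * (G * mat_diag n D' * H) = H * (G * (mat_diag n D' * H))"
    using c by (simp add: assoc_mult_mat[of G n n _ n _ n])
  also have "\<dots> = H * G * (mat_diag n D' * H)"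
    by (rule assoc_mult_mat[of _ n n _ n _ n, symmetric]) (use c in simp_all)
  also have "\<dots> = mat_diag n D' * H" using left_mult_one_mat[OF D'H] by (simp add: HG)
  also have "G * mat_diag n D * (mat_diag n D' * H) = G * mat_diag n D * mat_diag n D' * H"
    by (rule assoc_mult_mat[of _ n n _ n _ n, symmetric]) (use c in simp_all)
  also have "G * mat_diag n D * mat_diag n D' = G * (mat_diag n D * mat_diag n D')"
    by (rule assoc_mult_mat[of _ n n _ n _ n]) (use c in simp_all)
  finally show ?thesis by simp
qed

lemma conj_1ps_carrier:
  "g \<in> carrier_mat n n \<Longrightarrow> h \<in> carrier_mat n n \<Longrightarrow> conj_1ps n g e h \<in> carrier_mat n n"
  by (auto simp: conj_1ps_def intro!: mult_carrier_mat)

lemma conj_1ps_entry: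
  assumes "g \<in> carrier_mat n n" "h \<in> carrier_mat n n" "i < n" "j < n"
  shows "conj_1ps n g e h $$ (i, j) = (\<Sum>k<n. fls_const (g $$ (i, k) * h $$ (k, j)) * fls_X powi e k)"
  unfolding conj_1ps_def using assms
  by (subst conj_mat_diag_entry)
     (auto simp flip: fls_const_mult_const intro!: sum.cong simp: mult_ac)

lemma conj_1ps_mult:
  assumes "g \<in> carrier_mat n n" "h \<in> carrier_mat n n" "h * g = 1\<^sub>m n"
  shows "conj_1ps n g e h * conj_1ps n g e' h = conj_1ps n g (\<lambda>k. e k + e' k) h"
proof -
  have "map_mat fls_const h * map_mat fls_const g = 1\<^sub>m n"
    by (simp only: fls_const.mat_hom_mult[OF assms(2,1), symmetric] assms(3) fls_const.mat_hom_one)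
  then show ?thesis using assms(1,2)
    unfolding conj_1ps_def by (subst conj_mat_diag_mult) (simp_all add: power_int_add del: fls_X_power_int)
qed

lemma conj_1ps_zero:
  assumes "g \<in> carrier_mat n n" "h \<in> carrier_mat n n" "g * h = 1\<^sub>m n"
  shows "conj_1ps n g (\<lambda>_. 0) h = 1\<^sub>m n"
proof -
  have "map_mat fls_const g * map_mat fls_const h = 1\<^sub>m n"
    by (simp only: fls_const.mat_hom_mult[OF assms(1,2), symmetric] assms(3) fls_const.mat_hom_one)
  then show ?thesis using assms(1) by (simp add: conj_1ps_def)
qed

section \<open>Finite sums of monomials and their substitutions\<close>

lemma fls_nth_sum_powi:
  "fls_nth (\<Sum>k<n::nat. fls_const (c k) * fls_X powi e k :: 'k::field fls) m = (\<Sum>k<n. if m = e k then c k else 0)"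
  by (simp add: fls_nth_sum if_distrib cong: if_cong)

lemma fls_support_sum_powi:
  "{m. fls_nth (\<Sum>k<n::nat. fls_const (c k) * fls_X powi e k :: 'k::field fls) m \<noteq> 0} \<subseteq> e ` {..<n}"
proof
  fix m assume "m \<in> {m. fls_nth (\<Sum>k<n. fls_const (c k) * fls_X powi e k :: 'k fls) m \<noteq> 0}"
  then have "(\<Sum>k<n. if m = e k then c k else 0) \<noteq> 0" unfolding mem_Collect_eq fls_nth_sum_powi .
  from sum.not_neutral_contains_not_neutral[OF this]
  obtain k where "k \<in> {..<n}" "(if m = e k then c k else 0) \<noteq> 0" by blast
  then show "m \<in> e ` {..<n}" by (auto split: if_splits)
qed

lemma sum_powi_laurent_polys:
  "(\<Sum>k<n::nat. fls_const (c k) * fls_X powi e k :: 'k::field fls) \<in> laurent_polys"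
  unfolding laurent_polys_def using finite_subset[OF fls_support_sum_powi[of c e n]] by simp

text \<open>Exponents may coincide and coefficients may cancel, so the sum over the support is first
  enlarged to the image of \<open>e\<close> and then regrouped by \<open>k\<close>.\<close>

lemma laurent_subst_sum_powi:
  "laurent_subst (\<Sum>k<n::nat. fls_const (c k) * fls_X powi e k) x =
     (\<Sum>k<n. fls_const (fls_const (c k)) * x powi e k)" (is "laurent_subst ?f x = _")
proof -
  have "laurent_subst ?f x = (\<Sum>m\<in>e ` {..<n}. fls_const (fls_const (fls_nth ?f m)) * x powi m)"
    unfolding laurent_subst_def using fls_support_sum_powi[of c e n] by (intro sum.mono_neutral_left) auto
  also have "\<dots> = (\<Sum>m\<in>e ` {..<n}. \<Sum>k<n. if m = e k then fls_const (fls_const (c k)) * x powi m else 0)"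
    unfolding fls_nth_sum_powi fls_const.hom_sum sum_distrib_right by (intro sum.cong refl) simp
  also have "\<dots> = (\<Sum>k<n. \<Sum>m\<in>e ` {..<n}. if m = e k then fls_const (fls_const (c k)) * x powi m else 0)"
    by (rule sum.swap)
  also have "\<dots> = (\<Sum>k<n. fls_const (fls_const (c k)) * x powi e k)"
    by (intro sum.cong refl) simp
  finally show ?thesis .
qed

lemma polynomial_1ps_conj_1ps:
  assumes g: "g \<in> carrier_mat n n" and h: "h \<in> carrier_mat n n"
    and gh: "g * h = 1\<^sub>m n" and hg: "h * g = 1\<^sub>m n" and e: "\<And>k. k < n \<Longrightarrow> e k \<ge> 0"
  shows "polynomial_1ps n (conj_1ps n g e h)"
proof -
  have lp: "elements_mat (conj_1ps n g e' h) \<subseteq> laurent_polys" for e'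
    using conj_1ps_carrier[OF g h, of e'] sum_powi_laurent_polys
    by (auto simp: elements_mat_def conj_1ps_entry[OF g h] carrier_matD)
  have op: "elements_mat (conj_1ps n g e h) \<subseteq> ordinary_polys"
  proof
    fix f assume f: "f \<in> elements_mat (conj_1ps n g e h)"
    then obtain i j where ij: "i < n" "j < n" "f = conj_1ps n g e h $$ (i, j)"
      using conj_1ps_carrier[OF g h, of e] by (auto simp: elements_mat_def)
    then have eq: "f = (\<Sum>k<n. fls_const (g $$ (i, k) * h $$ (k, j)) * fls_X powi e k)"
      by (simp add: conj_1ps_entry[OF g h])
    have "fls_nth f m = 0" if "m < 0" for m
      unfolding eq fls_nth_sum_powi using that e by (intro sum.neutral) force
    then show "f \<in> ordinary_polys" using f lp[of e] by (auto simp: ordinary_polys_def)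
  qed
  define G where "G = map_mat (\<lambda>x. fls_const (fls_const x)) g"
  define H where "H = map_mat (\<lambda>x. fls_const (fls_const x)) h"
  have G: "G \<in> carrier_mat n n" and H: "H \<in> carrier_mat n n" using g h by (auto simp: G_def H_def)
  have "H = map_mat fls_const (map_mat fls_const h)" "G = map_mat fls_const (map_mat fls_const g)"
    by (auto simp: G_def H_def)
  then have HG: "H * G = 1\<^sub>m n"
    using fls_const.mat_hom_mult[OF h g] fls_const.mat_hom_one[of n, where 'a = 'a]
      fls_const.mat_hom_mult[of "map_mat fls_const h" n n "map_mat fls_const g" n] hg g h
      fls_const.mat_hom_one[of n, where 'a = "'a fls"]
    by simp
  \<comment> \<open>Substituting \<open>x\<close> for the variable affects only the diagonal factor;
    the group law thus reduces to multiplicativity of powers.\<close>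
  have subst: "map_mat (\<lambda>f. laurent_subst f x) (conj_1ps n g e h) = G * mat_diag n (\<lambda>k. x powi e k) * H" for x
  proof (rule eq_matI)
    fix i j assume "i < dim_row (G * mat_diag n (\<lambda>k. x powi e k) * H)"
      "j < dim_col (G * mat_diag n (\<lambda>k. x powi e k) * H)"
    then have ij: "i < n" "j < n" using G H by auto
    then have "map_mat (\<lambda>f. laurent_subst f x) (conj_1ps n g e h) $$ (i, j) =
        laurent_subst (\<Sum>k<n. fls_const (g $$ (i, k) * h $$ (k, j)) * fls_X powi e k) x"
      using conj_1ps_carrier[OF g h, of e] by (simp add: conj_1ps_entry[OF g h])
    also have "\<dots> = (\<Sum>k<n. G $$ (i, k) * x powi e k * H $$ (k, j))"
      unfolding laurent_subst_sum_powi using ij g h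
      by (intro sum.cong refl) (auto simp: G_def H_def mult_ac simp flip: fls_const_mult_const)
    finally show "map_mat (\<lambda>f. laurent_subst f x) (conj_1ps n g e h) $$ (i, j) =
        (G * mat_diag n (\<lambda>k. x powi e k) * H) $$ (i, j)"
      using ij by (simp add: conj_mat_diag_entry[OF G H])
  qed (use G H conj_1ps_carrier[OF g h, of e] in auto)
  \<comment> \<open>The inverse has the negated exponents; its entries may have poles, which
    \<open>laurent_polys\<close> allows.\<close>
  have inv: "conj_1ps n g e h * conj_1ps n g (\<lambda>k. - e k) h = 1\<^sub>m n"
    "conj_1ps n g (\<lambda>k. - e k) h * conj_1ps n g e h = 1\<^sub>m n"
    by (simp_all add: conj_1ps_mult[OF g h hg] conj_1ps_zero[OF g h gh])
  have "one_param_subgroup n (conj_1ps n g e h)"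
    unfolding one_param_subgroup_def subst
  proof (intro conjI bexI[of _ "conj_1ps n g (\<lambda>k. - e k) h"])
    show "G * mat_diag n (\<lambda>k. (var_s * var_t) powi e k) * H =
        G * mat_diag n (\<lambda>k. var_s powi e k) * H * (G * mat_diag n (\<lambda>k. var_t powi e k) * H)"
      by (simp add: conj_mat_diag_mult[OF G H HG] power_int_mult_distrib)
  qed (use inv lp conj_1ps_carrier[OF g h] in auto)
  then show ?thesis using op by (simp add: polynomial_1ps_def)
qed

text \<open>The determinants of \<open>g\<close> and \<open>h\<close> are constants with product 1,
  leaving only the diagonal.\<close>

lemma det_conj_1ps:
  assumes g: "g \<in> carrier_mat n n" and h: "h \<in> carrier_mat n n" and gh: "g * h = 1\<^sub>m n"
  shows "det (conj_1ps n g e h) = fls_X powi (\<Sum>k<n. e k)"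
proof -
  have "(\<Prod>k<n. fls_X powi e k) = (fls_X powi (\<Sum>k<n. e k) :: 'a fls)"
    by (induction n) (simp_all add: power_int_add del: fls_X_power_int)
  let ?D = "mat_diag n (\<lambda>k. fls_X powi e k :: 'a fls)"
  have "det ?D = prod_list (diag_mat ?D)"
    by (rule det_upper_triangular[of _ n]) (auto simp: mat_diag_def)
  also have "\<dots> = (\<Prod>k<n. fls_X powi e k)"
    by (simp del: fls_X_power_int add: prod_list_diag_prod atLeast0LessThan mat_diag_def)
  also note \<open>(\<Prod>k<n. fls_X powi e k) = fls_X powi (\<Sum>k<n. e k)\<close>
  finally have D: "det ?D = fls_X powi (\<Sum>k<n. e k)" .
  have "det g * det h = 1" using det_mult[OF g h] gh by simp
  then have 1: "fls_const (det g) * fls_const (det h) = 1" by simp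
  have "det (conj_1ps n g e h) = fls_const (det g) * det ?D * fls_const (det h)"
    unfolding conj_1ps_def using g h
    by (subst det_mult[of _ n] ; simp)+
  also have "\<dots> = fls_const (det g) * fls_const (det h) * det ?D" by (simp only: mult_ac)
  finally show ?thesis unfolding 1 D by simp
qed

lemma val_det_conj_1ps:
  assumes "g \<in> carrier_mat n n" "h \<in> carrier_mat n n" "g * h = 1\<^sub>m n"
  shows "val (det (conj_1ps n g (\<lambda>k. int (a k)) h)) = ereal (real (\<Sum>k<n. a k))"
  by (simp add: det_conj_1ps[OF assms] val_def)

section \<open>Diagonalisation of 1-parameter subgroups\<close>

lemma fls_const_powi: "fls_const x powi m = fls_const (x powi m)" for x :: "'k::field"
  by (simp add: power_int_def fls_const_power fls_inverse_const)

text \<open>The outer coefficient belongs to \<open>s\<close>, the inner one to \<open>t\<close>.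
  Only monomials with equal exponents occur in \<open>f(st)\<close>, which is the source of
  orthogonality below.\<close>

lemma laurent_subst_var_s_mult_var_t_nth:
  assumes "f \<in> laurent_polys"
  shows "fls_nth (fls_nth (laurent_subst f (var_s * var_t)) p) q = (if p = q then fls_nth f p else 0)"
proof -
  let ?S = "{m. fls_nth f m \<noteq> 0}"
  have fin: "finite ?S" using assms by (simp add: laurent_polys_def)
  have "fls_const (fls_const (fls_nth f m)) * (var_s * var_t) powi m =
      fls_const (fls_const (fls_nth f m) * fls_X powi m) * fls_X powi m" for m
    by (simp add: power_int_mult_distrib var_s_def var_t_def fls_const_powi mult_ac
        flip: fls_const_mult_const del: fls_X_power_int)
  then have "fls_nth (fls_nth (laurent_subst f (var_s * var_t)) p) q =
      (\<Sum>m\<in>?S. if m = p then if p = q then fls_nth f p else 0 else 0)"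
    unfolding laurent_subst_def fls_nth_sum
    by (intro sum.cong refl) simp
  also have "\<dots> = (if p = q then fls_nth f p else 0)" using fin by (simp add: sum.delta)
  finally show ?thesis .
qed

lemma laurent_subst_var_s_nth:
  assumes "f \<in> laurent_polys"
  shows "fls_nth (laurent_subst f var_s) p = fls_const (fls_nth f p)"
proof -
  let ?S = "{m. fls_nth f m \<noteq> 0}"
  have fin: "finite ?S" using assms by (simp add: laurent_polys_def)
  have "fls_nth (laurent_subst f var_s) p =
      (\<Sum>m\<in>?S. if m = p then fls_const (fls_nth f p) else 0)"
    unfolding laurent_subst_def fls_nth_sum var_s_def
    by (intro sum.cong refl) simp
  also have "\<dots> = fls_const (fls_nth f p)" using fin by (simp add: sum.delta)
  finally show ?thesis .
qed

lemma laurent_subst_var_t: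
  assumes "f \<in> laurent_polys"
  shows "laurent_subst f var_t = fls_const f"
proof -
  let ?S = "{m. fls_nth f m \<noteq> 0}"
  have fin: "finite ?S" using assms by (simp add: laurent_polys_def)
  have "laurent_subst f var_t = fls_const (\<Sum>m\<in>?S. fls_const (fls_nth f m) * fls_X powi m)"
    unfolding laurent_subst_def var_t_def fls_const_powi fls_const.hom_sum fls_const_mult_const ..
  also have "(\<Sum>m\<in>?S. fls_const (fls_nth f m) * fls_X powi m) = f"
  proof (rule fls_eqI)
    fix p
    have "fls_nth (\<Sum>m\<in>?S. fls_const (fls_nth f m) * fls_X powi m) p =
        (\<Sum>m\<in>?S. if m = p then fls_nth f p else 0)"
      unfolding fls_nth_sum by (intro sum.cong refl) simp
    also have "\<dots> = fls_nth f p" using fin by (simp add: sum.delta)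
    finally show "fls_nth (\<Sum>m\<in>?S. fls_const (fls_nth f m) * fls_X powi m) p = fls_nth f p" .
  qed
  finally show ?thesis .
qed

text \<open>The coefficient matrices of a 1-parameter subgroup are orthogonal idempotents with sum 1.
  Expanding \<open>det 1 = det (\<Sum>m. C m)\<close> along the rows yields an invertible matrix whose \<open>i\<close>-th row
  is the \<open>i\<close>-th row of some \<open>C (f i)\<close>, hence an eigenvector.\<close>

lemma one_param_subgroup_diagonalizable:
  fixes A :: "'k::field fls mat"
  assumes "one_param_subgroup n A"
  obtains g h e where "g \<in> carrier_mat n n" "h \<in> carrier_mat n n" "g * h = 1\<^sub>m n" "h * g = 1\<^sub>m n"
    "A = conj_1ps n g e h" "\<And>i. i < n \<Longrightarrow> \<exists>f\<in>elements_mat A. fls_nth f (e i) \<noteq> 0"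
proof -
  obtain B where A: "A \<in> carrier_mat n n" and Al: "elements_mat A \<subseteq> laurent_polys"
    and B: "B \<in> carrier_mat n n" "B * A = 1\<^sub>m n"
    and st: "map_mat (\<lambda>f. laurent_subst f (var_s * var_t)) A =
       map_mat (\<lambda>f. laurent_subst f var_s) A * map_mat (\<lambda>f. laurent_subst f var_t) A"
    using assms unfolding one_param_subgroup_def by blast
  have el: "A $$ (i, j) \<in> elements_mat A" if "i < n" "j < n" for i j
    using elements_matI[OF A that refl] .
  then have lp: "A $$ (i, j) \<in> laurent_polys" if "i < n" "j < n" for i j
    using that Al by blast
  define c where "c m i j = fls_nth (A $$ (i, j)) m" for m i j
  \<comment> \<open>Compare the coefficients at exponent \<open>p\<close> of \<open>s\<close> and
    \<open>q\<close> of \<open>t\<close> on both sides of \<open>A(st) = A(s) A(t)\<close>.\<close>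
  have orth: "(\<Sum>k<n. c p i k * c q k j) = (if p = q then c p i j else 0)" if ij: "i < n" "j < n" for i j p q
  proof -
    have "laurent_subst (A $$ (i, j)) (var_s * var_t) =
        map_mat (\<lambda>f. laurent_subst f (var_s * var_t)) A $$ (i, j)"
      using A ij by simp
    also have "\<dots> = (\<Sum>k<n. laurent_subst (A $$ (i, k)) var_s * fls_const (A $$ (k, j)))"
      unfolding st using A ij lp
      by (subst mult_mat_entry[of _ n]) (auto intro!: sum.cong simp: laurent_subst_var_t)
    finally have "fls_nth (fls_nth (laurent_subst (A $$ (i, j)) (var_s * var_t)) p) q =
        (\<Sum>k<n. c p i k * c q k j)"
      using ij lp by (simp add: fls_nth_sum laurent_subst_var_s_nth c_def)
    then show ?thesis
      unfolding laurent_subst_var_s_mult_var_t_nth[OF lp[OF ij]] c_def by (rule sym)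
  qed
  define S where "S = (\<Union>i<n. \<Union>j<n. {m. c m i j \<noteq> 0})"
  have S: "finite S" using lp by (auto simp: S_def c_def laurent_polys_def)
  define T where "T = mat n n (\<lambda>(i, j). \<Sum>m\<in>S. c m i j)"
  have T: "T \<in> carrier_mat n n" by (simp add: T_def)
  \<comment> \<open>\<open>T\<close> is the sum of all coefficient matrices, that is,
    \<open>A\<close> evaluated at 1. Orthogonality gives \<open>A * T = A\<close>, and cancelling
    the invertible \<open>A\<close> yields \<open>T = 1\<close>.\<close>
  have "A * map_mat fls_const T = A"
  proof (rule eq_matI)
    fix i j assume "i < dim_row A" "j < dim_col A"
    then have ij: "i < n" "j < n" using A by auto
    show "(A * map_mat fls_const T) $$ (i, j) = A $$ (i, j)"
    proof (rule fls_eqI)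
      fix p
      have "(A * map_mat fls_const T) $$ (i, j) = (\<Sum>k<n. A $$ (i, k) * fls_const (\<Sum>m\<in>S. c m k j))"
        using A T ij by (subst mult_mat_entry[of _ n]) (auto intro!: sum.cong simp: T_def)
      then have "fls_nth ((A * map_mat fls_const T) $$ (i, j)) p = (\<Sum>k<n. \<Sum>m\<in>S. c p i k * c m k j)"
        by (simp add: fls_nth_sum sum_distrib_left c_def del: fls_const.hom_sum)
      also have "\<dots> = (\<Sum>m\<in>S. \<Sum>k<n. c p i k * c m k j)" by (rule sum.swap)
      also have "\<dots> = (\<Sum>m\<in>S. if p = m then c p i j else 0)" using ij by (simp add: orth)
      also have "\<dots> = (if p \<in> S then c p i j else 0)" using S by (rule sum.delta')
      also have "\<dots> = c p i j" using ij by (auto simp: S_def)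
      finally show "fls_nth ((A * map_mat fls_const T) $$ (i, j)) p = fls_nth (A $$ (i, j)) p"
        by (simp add: c_def)
    qed
  qed (use A T in auto)
  then have "B * (A * map_mat fls_const T) = 1\<^sub>m n" using B by simp
  moreover have "B * (A * map_mat fls_const T) = B * A * map_mat fls_const T"
    using A B(1) T by (intro assoc_mult_mat[symmetric, of _ n n _ n _ n]) auto
  ultimately have T1: "map_mat fls_const T = 1\<^sub>m n" using B T by simp
  have T_one: "(\<Sum>m\<in>S. c m i j) = (if i = j then 1 else 0)" if ij: "i < n" "j < n" for i j
  proof -
    have "fls_const (\<Sum>m\<in>S. c m i j) = map_mat fls_const T $$ (i, j)" using ij by (simp add: T_def)
    also have "\<dots> = fls_const (if i = j then 1 else 0)" using ij by (simp add: T1)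
    finally have "fls_nth (fls_const (\<Sum>m\<in>S. c m i j)) 0 = fls_nth (fls_const (if i = j then 1 else 0)) 0"
      by (rule arg_cong)
    then show ?thesis by (simp only: fls_const_nth if_True refl)
  qed
  \<comment> \<open>The multilinear row expansion runs over functions between naturals, so the
    integer exponents in \<open>S\<close> are enumerated first.\<close>
  obtain \<phi> where \<phi>: "bij_betw \<phi> {0..<card S} S" using ex_bij_betw_nat_finite[OF S] by blast
  define row_of where "row_of i m = vec n (\<lambda>j. c (\<phi> m) i j)" for i m
  have "mat\<^sub>r n n (\<lambda>i. finsum_vec TYPE('k) n (row_of i) {0..<card S}) = 1\<^sub>m n"
  proof (rule eq_matI)
    fix i j assume "i < dim_row (1\<^sub>m n :: 'k mat)" "j < dim_col (1\<^sub>m n :: 'k mat)"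
    then have ij: "i < n" "j < n" by auto
    then have "mat\<^sub>r n n (\<lambda>i. finsum_vec TYPE('k) n (row_of i) {0..<card S}) $$ (i, j) =
        (\<Sum>m\<in>{0..<card S}. c (\<phi> m) i j)"
      by (simp add: row_of_def index_finsum_vec)
    also have "\<dots> = (\<Sum>m\<in>S. c m i j)" by (rule sum.reindex_bij_betw[OF \<phi>])
    finally show "mat\<^sub>r n n (\<lambda>i. finsum_vec TYPE('k) n (row_of i) {0..<card S}) $$ (i, j) =
        1\<^sub>m n $$ (i, j)"
      using ij by (simp add: T_one)
  qed auto
  then have "(\<Sum>f | (\<forall>i\<in>{0..<n}. f i \<in> {0..<card S}) \<and> (\<forall>i. i \<notin> {0..<n} \<longrightarrow> f i = i).
      det (mat\<^sub>r n n (\<lambda>i. row_of i (f i)))) = 1"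
    using det_linear_rows_sum[of "{0..<card S}" row_of n] det_one[of n, where 'a = 'k]
    by (simp add: row_of_def)
  then have "(\<Sum>f | (\<forall>i\<in>{0..<n}. f i \<in> {0..<card S}) \<and> (\<forall>i. i \<notin> {0..<n} \<longrightarrow> f i = i).
      det (mat\<^sub>r n n (\<lambda>i. row_of i (f i)))) \<noteq> 0" by simp
  from sum.not_neutral_contains_not_neutral[OF this]
  obtain f0 where f0: "\<forall>i\<in>{0..<n}. f0 i \<in> {0..<card S}" and df: "det (mat\<^sub>r n n (\<lambda>i. row_of i (f0 i))) \<noteq> 0"
    by blast
  define f where "f i = \<phi> (f0 i)" for i
  have f: "f i \<in> S" if "i < n" for i
    using f0 that bij_betw_apply[OF \<phi>] by (simp add: f_def)
  define h where "h = mat\<^sub>r n n (\<lambda>i. row_of i (f0 i))"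
  have h: "h \<in> carrier_mat n n" and h_entry: "\<And>i j. i < n \<Longrightarrow> j < n \<Longrightarrow> h $$ (i, j) = c (f i) i j"
    by (simp_all add: h_def row_of_def f_def)
  obtain g where g: "g \<in> carrier_mat n n" "h * g = 1\<^sub>m n" "g * h = 1\<^sub>m n"
    using obtain_inverse_mat[OF h] df by (auto simp: h_def)
  let ?D = "mat_diag n (\<lambda>k. fls_X powi f k)"
  \<comment> \<open>Row \<open>i\<close> of \<open>h\<close> is a row of the coefficient matrix at
    \<open>f i\<close>. By orthogonality, multiplying it by \<open>A\<close> leaves only the
    exponent \<open>f i\<close>, so it is a left eigenvector.\<close>
  have "map_mat fls_const h * A = ?D * map_mat fls_const h"
  proof (rule eq_matI)
    fix i j assume "i < dim_row (?D * map_mat fls_const h)" "j < dim_col (?D * map_mat fls_const h)"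
    then have ij: "i < n" "j < n" using h by (auto simp: mat_diag_def)
    show "(map_mat fls_const h * A) $$ (i, j) = (?D * map_mat fls_const h) $$ (i, j)"
    proof (rule fls_eqI)
      fix q
      have "(map_mat fls_const h * A) $$ (i, j) = (\<Sum>k<n. fls_const (c (f i) i k) * A $$ (k, j))"
        using A h ij by (subst mult_mat_entry[of _ n]) (auto intro!: sum.cong simp: h_entry)
      then have "fls_nth ((map_mat fls_const h * A) $$ (i, j)) q = (\<Sum>k<n. c (f i) i k * c q k j)"
        by (simp add: fls_nth_sum c_def)
      also have "\<dots> = fls_nth ((?D * map_mat fls_const h) $$ (i, j)) q"
        using h ij by (subst mat_diag_mult_left[of _ n n]) (auto simp: orth h_entry)
      finally show "fls_nth ((map_mat fls_const h * A) $$ (i, j)) q =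
          fls_nth ((?D * map_mat fls_const h) $$ (i, j)) q" .
    qed
  qed (use A h in \<open>auto simp: mat_diag_def\<close>)
  moreover have gh: "map_mat fls_const g * map_mat fls_const h = 1\<^sub>m n"
    by (simp only: fls_const.mat_hom_mult[OF g(1) h, symmetric] g(3) fls_const.mat_hom_one)
  have "map_mat fls_const g * (map_mat fls_const h * A) = A"
    using A g(1) h gh by (subst assoc_mult_mat[symmetric, of _ n n _ n _ n]) auto
  ultimately have "A = map_mat fls_const g * (?D * map_mat fls_const h)" by simp
  also have "\<dots> = conj_1ps n g f h"
    unfolding conj_1ps_def using g(1) h
    by (intro assoc_mult_mat[symmetric, of _ n n _ n _ n]) auto
  finally have "A = conj_1ps n g f h" .
  moreover have "\<exists>u\<in>elements_mat A. fls_nth u (f i) \<noteq> 0" if "i < n" for i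
    using f that el by (fastforce simp: S_def c_def)
  ultimately show ?thesis using that g h by blast
qed

section \<open>Valuations and weights\<close>

text \<open>Every diagonal exponent occurs in some entry of \<open>A\<close>, so the absence of
  negative powers makes all exponents natural numbers.\<close>

lemma polynomial_1ps_diagonalizable:
  assumes "polynomial_1ps n A"
  obtains g h a where "g \<in> carrier_mat n n" "h \<in> carrier_mat n n" "g * h = 1\<^sub>m n" "h * g = 1\<^sub>m n"
    "A = conj_1ps n g (\<lambda>k. int (a k)) h"
proof -
  from assms have A: "one_param_subgroup n A" "elements_mat A \<subseteq> ordinary_polys"
    by (auto simp: polynomial_1ps_def)
  obtain g h e where gh: "g \<in> carrier_mat n n" "h \<in> carrier_mat n n" "g * h = 1\<^sub>m n" "h * g = 1\<^sub>m n"
    and eq: "A = conj_1ps n g e h" and e: "\<And>i. i < n \<Longrightarrow> \<exists>f\<in>elements_mat A. fls_nth f (e i) \<noteq> 0"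
    using one_param_subgroup_diagonalizable[OF A(1)] by blast
  have "e i \<ge> 0" if i: "i < n" for i
  proof -
    obtain f where "f \<in> elements_mat A" "fls_nth f (e i) \<noteq> 0" using e[OF i] by blast
    then have "\<not> e i < 0" using A(2) by (auto simp: ordinary_polys_def)
    then show ?thesis by simp
  qed
  then have "mat_diag n (\<lambda>k. fls_X powi e k) = mat_diag n (\<lambda>k. fls_X powi int (nat (e k)) :: 'a fls)"
    by (auto simp: mat_diag_def)
  then have "A = conj_1ps n g (\<lambda>k. int (nat (e k))) h" by (simp only: eq conj_1ps_def)
  then show ?thesis by (rule that[OF gh])
qed

lemma act_eq_tensor_act: "act n d lam v = tensor_act n d lam (\<lambda>J. fls_const (v J))"
  by (intro ext) (simp add: act_def tensor_act_def)

lemma prod_map_mat_fls_const: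
  fixes h :: "nat \<Rightarrow> 'a::comm_ring_1 mat"
  assumes h: "\<And>i. i < d \<Longrightarrow> h i \<in> carrier_mat n n"
    and I: "I \<in> multi_indices n d" and J: "J \<in> multi_indices n d"
  shows "(\<Prod>i<d. map_mat fls_const (h i) $$ (I i, J i)) = fls_const (\<Prod>i<d. h i $$ (I i, J i))"
  unfolding fls_const.hom_prod
proof (rule prod.cong[OF refl])
  fix i assume "i \<in> {..<d}"
  then have "i < d" by simp
  then show "map_mat fls_const (h i) $$ (I i, J i) = fls_const (h i $$ (I i, J i))"
    using h[of i] multi_indicesD[OF I, of i] multi_indicesD[OF J, of i] by auto
qed

lemma tensor_act_const:
  assumes "\<And>i. i < d \<Longrightarrow> h i \<in> carrier_mat n n" "I \<in> multi_indices n d"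
  shows "tensor_act n d (\<lambda>i. map_mat fls_const (h i)) (\<lambda>J. fls_const (v J)) I =
    fls_const (tensor_act n d h v I)"
  unfolding tensor_act_def fls_const.hom_sum
  by (intro sum.cong refl) (simp only: prod_map_mat_fls_const[OF assms] fls_const.hom_mult)

lemma val_ge_iff: "ereal (of_int m) \<le> val f \<longleftrightarrow> (\<forall>k<m. fls_nth f k = 0)"
proof (cases "f = 0")
  case False
  then show ?thesis
    using nth_fls_subdegree_nonzero[OF False] fls_eq0_below_subdegree
      fls_subdegree_geI[OF False, of m]
    by (auto simp: val_def not_le)
qed (simp add: val_def)

text \<open>Combinations with coefficients in \<open>K\<close> cannot lower the valuation; used for
  a base change and for its inverse, this makes the valuation independent of the basis.\<close>

lemma val_tensor_act_const_ge:
  assumes h: "\<And>i. i < d \<Longrightarrow> h i \<in> carrier_mat n n" and I: "I \<in> multi_indices n d"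
    and u: "\<And>J. J \<in> multi_indices n d \<Longrightarrow> ereal (of_int m) \<le> val (u J)"
  shows "ereal (of_int m) \<le> val (tensor_act n d (\<lambda>i. map_mat fls_const (h i)) u I)"
  unfolding val_ge_iff
proof (intro allI impI)
  fix k assume k: "k < m"
  have "fls_nth ((\<Prod>i<d. map_mat fls_const (h i) $$ (I i, J i)) * u J) k = 0"
    if J: "J \<in> multi_indices n d" for J
    using u[OF J] k by (simp only: prod_map_mat_fls_const[OF h I J] val_ge_iff fls_mult_const_nth mult_zero_right)
  then show "fls_nth (tensor_act n d (\<lambda>i. map_mat fls_const (h i)) u I) k = 0"
    by (simp add: tensor_act_def fls_nth_sum)
qed

text \<open>Used for a tuple with varying components and, with constant families, for one
  1-parameter subgroup acting diagonally.\<close>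

locale diagonal_1ps =
  fixes n d :: nat and g h :: "nat \<Rightarrow> 'k::field mat" and a :: "nat \<Rightarrow> nat \<Rightarrow> nat" and lam
  assumes g: "i < d \<Longrightarrow> g i \<in> carrier_mat n n" and h: "i < d \<Longrightarrow> h i \<in> carrier_mat n n"
    and gh: "i < d \<Longrightarrow> g i * h i = 1\<^sub>m n" and hg: "i < d \<Longrightarrow> h i * g i = 1\<^sub>m n"
    and lam: "i < d \<Longrightarrow> lam i = conj_1ps n (g i) (\<lambda>k. int (a i k)) (h i)"
begin

text \<open>In eigencoordinates \<open>lam i\<close> is diagonal, so coordinate \<open>I\<close> is
  scaled by the monomial whose degree is the weight of \<open>I\<close>.\<close>

lemma const_h_act:
  assumes I: "I \<in> multi_indices n d"
  shows "tensor_act n d (\<lambda>i. map_mat fls_const (h i)) (act n d lam v) I =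
    fls_X ^ (\<Sum>i<d. a i (I i)) * fls_const (tensor_act n d h v I)"
proof -
  let ?D = "\<lambda>i. mat_diag n (\<lambda>k. fls_X powi int (a i k) :: 'k fls)"
  have eq: "map_mat fls_const (h i) * lam i = ?D i * map_mat fls_const (h i)" if i: "i < d" for i
  proof -
    let ?g = "map_mat fls_const (g i)" and ?h = "map_mat fls_const (h i)"
    have c: "?g \<in> carrier_mat n n" "?h \<in> carrier_mat n n" "?D i * ?h \<in> carrier_mat n n"
      using g[OF i] h[OF i] by (auto intro!: mult_carrier_mat[of _ n n])
    have "?h * ?g = 1\<^sub>m n"
      by (simp only: fls_const.mat_hom_mult[OF h[OF i] g[OF i], symmetric] hg[OF i] fls_const.mat_hom_one)
    moreover have "?h * (?g * (?D i * ?h)) = ?h * ?g * (?D i * ?h)"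
      by (rule assoc_mult_mat[symmetric, OF c(2,1,3)])
    moreover have "?g * ?D i * ?h = ?g * (?D i * ?h)"
      by (rule assoc_mult_mat[OF c(1) mat_diag_dim c(2)])
    ultimately show ?thesis using left_mult_one_mat[OF c(3)] lam[OF i] by (simp add: conj_1ps_def)
  qed
  have "tensor_act n d (\<lambda>i. map_mat fls_const (h i)) (act n d lam v) I =
      tensor_act n d (\<lambda>i. map_mat fls_const (h i) * lam i) (\<lambda>J. fls_const (v J)) I"
    unfolding act_eq_tensor_act
    by (rule tensor_act_mult[symmetric]) (use I g h lam in \<open>auto simp: conj_1ps_carrier\<close>)
  also have "\<dots> = tensor_act n d (\<lambda>i. ?D i * map_mat fls_const (h i)) (\<lambda>J. fls_const (v J)) I"
    by (rule tensor_act_cong) (use eq in auto)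
  also have "\<dots> = tensor_act n d ?D
      (tensor_act n d (\<lambda>i. map_mat fls_const (h i)) (\<lambda>J. fls_const (v J))) I"
    by (rule tensor_act_mult) (use I h in auto)
  also have "\<dots> = (\<Prod>i<d. fls_X powi int (a i (I i))) * fls_const (tensor_act n d h v I)"
    by (simp only: tensor_act_mat_diag[OF I] tensor_act_const[of d h n I v, OF h I])
  also have "(\<Prod>i<d. fls_X powi int (a i (I i)) :: 'k fls) = fls_X ^ (\<Sum>i<d. a i (I i))"
    by (simp add: power_sum del: fls_X_power_int)
  finally show ?thesis .
qed

lemma act_eq:
  assumes I: "I \<in> multi_indices n d"
  shows "act n d lam v I = tensor_act n d (\<lambda>i. map_mat fls_const (g i))
    (tensor_act n d (\<lambda>i. map_mat fls_const (h i)) (act n d lam v)) I"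
proof -
  have eq: "map_mat fls_const (g i) * map_mat fls_const (h i) = 1\<^sub>m n" if i: "i < d" for i
    by (simp only: fls_const.mat_hom_mult[OF g[OF i] h[OF i], symmetric] gh[OF i] fls_const.mat_hom_one)
  have "act n d lam v I = tensor_act n d (\<lambda>i. 1\<^sub>m n) (act n d lam v) I"
    by (rule tensor_act_one[OF I, symmetric])
  also have "\<dots> = tensor_act n d (\<lambda>i. map_mat fls_const (g i) * map_mat fls_const (h i)) (act n d lam v) I"
    by (rule tensor_act_cong) (use eq in auto)
  also have "\<dots> = tensor_act n d (\<lambda>i. map_mat fls_const (g i))
      (tensor_act n d (\<lambda>i. map_mat fls_const (h i)) (act n d lam v)) I"
    by (rule tensor_act_mult) (use I g h in auto)
  finally show ?thesis .
qed

text \<open>Each eigencoordinate is a monomial times a constant: its valuation is at least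
  \<open>m\<close> exactly when the constant vanishes or the weight reaches
  \<open>m\<close>.\<close>

lemma tensor_val_ge_iff:
  "ereal (real m) \<le> tensor_val n d (act n d lam v) \<longleftrightarrow> weight_ge n d h a m v"
proof -
  let ?u = "act n d lam v" and ?h = "\<lambda>i. map_mat fls_const (h i)"
  have m: "ereal (real m) = ereal (of_int (int m))" by simp
  have "ereal (real m) \<le> tensor_val n d ?u \<longleftrightarrow> (\<forall>I\<in>multi_indices n d. ereal (of_int (int m)) \<le> val (?u I))"
    by (simp add: tensor_val_def le_INF_iff)
  \<comment> \<open>The constant matrices \<open>h\<close> lead to eigencoordinates and
    \<open>g\<close> leads back, so the bound passes in both directions.\<close>
  also have "\<dots> \<longleftrightarrow> (\<forall>I\<in>multi_indices n d. ereal (of_int (int m)) \<le> val (tensor_act n d ?h ?u I))"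
    using val_tensor_act_const_ge[of d h n _ "int m" ?u] h
      val_tensor_act_const_ge[of d g n _ "int m" "tensor_act n d ?h ?u"] g act_eq
    by (metis (no_types, lifting))
  also have "\<dots> \<longleftrightarrow> weight_ge n d h a m v"
    unfolding weight_ge_def val_ge_iff
    by (intro ball_cong refl) (auto simp: const_h_act not_less simp flip: of_nat_sum)
  finally show ?thesis .
qed

lemma act_eq_0_imp_eq_0:
  assumes "\<And>I. I \<in> multi_indices n d \<Longrightarrow> act n d lam v I = 0" and I: "I \<in> multi_indices n d"
  shows "v I = 0"
proof -
  have "tensor_act n d h v J = 0" if J: "J \<in> multi_indices n d" for J
  proof -
    have "tensor_act n d (\<lambda>i. map_mat fls_const (h i)) (act n d lam v) J = 0"
      using assms(1) by (simp add: tensor_act_def)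
    then show ?thesis using const_h_act[OF J] by simp
  qed
  then have "tensor_act n d g (tensor_act n d h v) I = 0" by (simp add: tensor_act_def)
  moreover have "tensor_act n d (\<lambda>i. g i * h i) v I = tensor_act n d g (tensor_act n d h v) I"
    by (rule tensor_act_mult) (use I g h in auto)
  moreover have "tensor_act n d (\<lambda>i. g i * h i) v I = tensor_act n d (\<lambda>i. 1\<^sub>m n) v I"
    by (rule tensor_act_cong) (use gh in auto)
  ultimately show ?thesis using tensor_act_one[OF I, of v] by simp
qed

end

section \<open>Comparison of the two infima\<close>

lemma tensor_val_cases:
  obtains "\<And>I. I \<in> multi_indices n d \<Longrightarrow> u I = 0" | z where "tensor_val n d u = ereal (of_int z)"
proof (cases "\<forall>I\<in>multi_indices n d. u I = 0")
  case False
  then have ne: "multi_indices n d \<noteq> {}" by auto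
  have "Min ((\<lambda>I. val (u I)) ` multi_indices n d) \<in> (\<lambda>I. val (u I)) ` multi_indices n d"
    using ne by (intro Min_in) auto
  moreover have eq: "tensor_val n d u = Min ((\<lambda>I. val (u I)) ` multi_indices n d)"
    unfolding tensor_val_def using ne by (intro Min_Inf[symmetric]) auto
  ultimately obtain I where I: "I \<in> multi_indices n d" "tensor_val n d u = val (u I)" by auto
  obtain J where J: "J \<in> multi_indices n d" "u J \<noteq> 0" using False by auto
  have "tensor_val n d u \<le> val (u J)" unfolding tensor_val_def by (rule INF_lower[OF J(1)])
  then have "u I \<noteq> 0" using J I by (auto simp: val_def)
  then show ?thesis using that(2) I by (simp add: val_def)
qed (use that(1) in blast)

lemma tensor_val_zero:
  assumes "\<And>I. I \<in> multi_indices n d \<Longrightarrow> u I = 0"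
  shows "tensor_val n d u = \<infinity>"
  \<comment> \<open>Without multi-indices, as for \<open>n = 0\<close> and \<open>d \<ge> 1\<close>,
    the infimum is over the empty set and equals the top element.\<close>
  using assms by (cases "multi_indices n d = {}") (auto simp: tensor_val_def val_def top_ereal_def)

text \<open>The substantial inequality, for one tuple at a time: equalising the flags of
  \<open>lam\<close> gives a single 1-parameter subgroup with at most the same quotient.\<close>

lemma symm_stable_rank_le:
  fixes v :: "(nat \<Rightarrow> nat) \<Rightarrow> 'k::field"
  assumes d: "d \<ge> 1" and v: "v \<in> symmetric_tensors n d"
    and pol: "polynomial_1ps_prod n d lam" and pos: "tensor_val n d (act n d lam v) > 0"
  shows "\<exists>A. polynomial_1ps n A \<and> tensor_val n d (act n d (\<lambda>_. A) v) > 0 \<and>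
    ereal (real d) * (val (det A) / tensor_val n d (act n d (\<lambda>_. A) v)) \<le>
    (\<Sum>i<d. val (det (lam i))) / tensor_val n d (act n d lam v)"
proof -
  have "\<exists>g h a. g \<in> carrier_mat n n \<and> h \<in> carrier_mat n n \<and> g * h = 1\<^sub>m n \<and> h * g = 1\<^sub>m n \<and>
      lam i = conj_1ps n g (\<lambda>k. int (a k)) h" if "i < d" for i
    using polynomial_1ps_diagonalizable[of n "lam i"] pol that
    unfolding polynomial_1ps_prod_def by metis
  then obtain g h a where gha: "\<And>i. i < d \<Longrightarrow> g i \<in> carrier_mat n n \<and> h i \<in> carrier_mat n n \<and>
      g i * h i = 1\<^sub>m n \<and> h i * g i = 1\<^sub>m n \<and> lam i = conj_1ps n (g i) (\<lambda>k. int (a i k)) (h i)"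
    by metis
  interpret diagonal_1ps n d g h a lam by unfold_locales (use gha in auto)
  have sum: "(\<Sum>i<d. val (det (lam i))) = ereal (real (\<Sum>i<d. \<Sum>j<n. a i j))"
    using gha by (simp add: val_det_conj_1ps)
  show ?thesis
  proof (cases rule: tensor_val_cases[of n d "act n d lam v"])
    case 1
    then have "v I = 0" if "I \<in> multi_indices n d" for I using act_eq_0_imp_eq_0 that by blast
    \<comment> \<open>For zero coordinates every denominator is infinite, both quotients are 0, and
      any component of \<open>lam\<close> is a witness.\<close>
    then have act0: "tensor_val n d (act n d A v) = \<infinity>" for A
      by (intro tensor_val_zero) (simp add: act_def)
    have "polynomial_1ps n (lam 0)" using pol d by (simp add: polynomial_1ps_prod_def)
    then show ?thesis by (intro exI[of _ "lam 0"]) (simp add: act0)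
  next
    case (2 z)
    define m where "m = nat z"
    have m: "tensor_val n d (act n d lam v) = ereal (real m)" "m > 0"
      using 2 pos by (auto simp: m_def)
    then have w: "weight_ge n d h a m v" using tensor_val_ge_iff[of m v] by simp
    have dh: "det (h i) \<noteq> 0" if "i < d" for i
      using det_mult[OF g[OF that] h[OF that]] gh[OF that] by auto
    obtain q c N where q: "q \<in> carrier_mat n n" "det q \<noteq> 0" and N: "N > (0::nat)"
      and wq: "weight_ge n d (\<lambda>_. q) (\<lambda>_. c) (N * m) v"
      and c: "d * (\<Sum>j<n. c j) = N * (\<Sum>i<d. \<Sum>j<n. a i j)"
      using weight_ge_equalize[OF v d h dh w] by blast
    obtain p where p: "p \<in> carrier_mat n n" "q * p = 1\<^sub>m n" "p * q = 1\<^sub>m n"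
      using obtain_inverse_mat[OF q] by blast
    define A where "A = conj_1ps n p (\<lambda>k. int (c k)) q"
    interpret A: diagonal_1ps n d "\<lambda>_. p" "\<lambda>_. q" "\<lambda>_. c" "\<lambda>_. A"
      by unfold_locales (use p q A_def in auto)
    let ?T = "tensor_val n d (act n d (\<lambda>_. A) v)"
    \<comment> \<open>The valuation may exceed \<open>N * m\<close>, which only shrinks the quotient
      since its numerator is nonnegative; \<open>N\<close> then cancels against the scaled total
      weight.\<close>
    have T: "ereal (real (N * m)) \<le> ?T" using A.tensor_val_ge_iff wq by blast
    have Nm: "0 < real (N * m)" using N m by simp
    have "0 < ?T" using Nm T by (metis ereal_less(2) less_le_trans)
    moreover have "polynomial_1ps n A"
      unfolding A_def by (rule polynomial_1ps_conj_1ps) (use p q in auto)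
    moreover have "ereal (real d) * (val (det A) / ?T) \<le> ereal (real (\<Sum>i<d. \<Sum>j<n. a i j)) / ereal (real m)"
    proof (cases ?T)
      case (real r)
      have r: "real (N * m) \<le> r" using T real by simp
      have "real d * (real (\<Sum>j<n. c j) / r) = real N * real (\<Sum>i<d. \<Sum>j<n. a i j) / r"
        using arg_cong[OF c, of real] by (simp only: of_nat_mult times_divide_eq_right)
      also have "\<dots> \<le> real N * real (\<Sum>i<d. \<Sum>j<n. a i j) / real (N * m)"
        using r Nm by (intro divide_left_mono mult_nonneg_nonneg of_nat_0_le_iff) auto
      also have "\<dots> = real (\<Sum>i<d. \<Sum>j<n. a i j) / real m" using N by simp
      finally show ?thesis
        using real r Nm m(2) val_det_conj_1ps[OF p(1) q(1) p(3), of c] by (simp add: A_def)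
    next
      case PInf
      then show ?thesis using m(2) by (simp add: sum_nonneg)
    qed (use T in simp)
    ultimately show ?thesis using m(1) sum by (intro exI[of _ A]) auto
  qed
qed

theorem theorem5:
  fixes v :: "(nat \<Rightarrow> nat) \<Rightarrow> 'k::field" and n d :: nat
  assumes "perfect_field TYPE('k)" and "d \<ge> 1" and "v \<in> symmetric_tensors n d"
  shows "symm_stable_rank n d v = stable_rank n d v"
proof (rule antisym)
  show "symm_stable_rank n d v \<le> stable_rank n d v"
    unfolding symm_stable_rank_def stable_rank_def
  proof (rule INF_mono)
    fix lam :: "nat \<Rightarrow> 'k fls mat"
    assume "lam \<in> {lam. polynomial_1ps_prod n d lam \<and> 0 < tensor_val n d (act n d lam v)}"
    then show "\<exists>A\<in>{A. polynomial_1ps n A \<and> 0 < tensor_val n d (act n d (\<lambda>_. A) v)}.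
        ereal (real d) * (val (det A) / tensor_val n d (act n d (\<lambda>_. A) v)) \<le>
        (\<Sum>i<d. val (det (lam i))) / tensor_val n d (act n d lam v)"
      using symm_stable_rank_le[OF assms(2,3), of lam] by auto
  qed
next
  show "stable_rank n d v \<le> symm_stable_rank n d v"
    unfolding symm_stable_rank_def stable_rank_def
  proof (rule INF_mono)
    fix A :: "'k fls mat"
    assume A: "A \<in> {A. polynomial_1ps n A \<and> 0 < tensor_val n d (act n d (\<lambda>_. A) v)}"
    let ?T = "tensor_val n d (act n d (\<lambda>_. A) v)"
    \<comment> \<open>For the reverse inequality \<open>A\<close> becomes a constant tuple.
      Diagonalising it shows that \<open>val (det A)\<close> is a finite real, so the
      \<open>d\<close>-fold sum of determinant valuations can be compared with multiplication by
      \<open>d\<close>.\<close>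
    obtain g h a where "g \<in> carrier_mat n n" "h \<in> carrier_mat n n" "g * h = 1\<^sub>m n"
      "A = conj_1ps n g (\<lambda>k. int (a k)) h"
      using polynomial_1ps_diagonalizable[of n A] A by blast
    then have dA: "val (det A) = ereal (real (\<Sum>k<n. a k))" by (simp only: val_det_conj_1ps)
    have "(\<Sum>i<d. val (det A)) / ?T \<le> ereal (real d) * (val (det A) / ?T)"
      using A by (cases ?T) (simp_all add: dA)
    then show "\<exists>lam\<in>{lam. polynomial_1ps_prod n d lam \<and> 0 < tensor_val n d (act n d lam v)}.
        (\<Sum>i<d. val (det (lam i))) / tensor_val n d (act n d lam v) \<le>
        ereal (real d) * (val (det A) / ?T)"
      using A by (intro bexI[of _ "\<lambda>_. A"]) (auto simp: polynomial_1ps_prod_def)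
  qed
qed

end
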